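(* Let $N$ be a positive integer, $\check\lambda,\check\lambda'\in\mathbb Z$, $\lambda=\sqrt N\check\lambda$, $\lambda'=\sqrt N\check\lambda'$. For distinct points $z,z'\in\mathbb P\setminus P$ one has $$[j(z'),V_\lambda(z)]=0,\qquad V_{\lambda'}(z')V_\lambda(z)=(-1)^{\lambda\lambda'}V_\lambda(z)V_{\lambda'}(z').$$
   Context: $\mathbb P$ is a complex projective line, $K$ its canonical bundle, $P\in\mathbb P$ fixed; coordinates $u$ are meromorphic functions whose only pole is a simple pole at $P$. $\mathfrak m_P$ is the space of meromorphic functions regular and vanishing at $P$, $\mathfrak m_P^z\subset\mathfrak m_P$ those also regular at $z$; $\mathbb W=S^*\mathfrak m_P$, $\mathbb W^z=S^*\mathfrak m_P^z$, vacuum $\mathbf 1$. $\kappa$ is a square root of $K$ with its connection $\nabla$ having a regular singular point at $P$ and otherwise regular; for a coordinate $u$ there is a section $\sqrt{du}$ with $\nabla\sqrt{du}=0$ away from $P$. $\mathcal K^*(\kappa)$ is the set of nonzero meromorphic sections of $\kappa$; $\mathcal K^*_l(\kappa)=\{\sigma:\mathrm{Res}_P(\sigma^{-1}\nabla\sigma)=l\}$, $l\in\mathbb Z$; a superscript $z$ denotes sections regular and nonvanishing at $z$. $\tilde{\mathbb W}_l$ is the space of maps $\rho:\mathcal K_l^*(\kappa)\to\mathbb W$ with $\rho(t\sigma)=t^{Nl}\rho(\sigma)$ for $t\in\mathbb C^*$ and nonzero on only finitely many $\mathbb C^*$-orbits; $\tilde{\mathbb W}_l^z$ is defined similarly by maps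 $\mathcal K_l^*(\kappa)^z\to\mathbb W^z$. $\tilde{\mathbb W}=\oplus_l\tilde{\mathbb W}_l$, $\tilde{\mathbb W}^z=\oplus_l\tilde{\mathbb W}^z_l$. For $\mathtt v\in\mathbb W$, $\sigma\in\mathcal K_l^*(\kappa)$, $\mathtt v\hat\otimes E[\sigma]$ is the map $t\sigma\mapsto t^{Nl}\mathtt v$, zero off $\mathbb C^*\sigma$; so $\mathtt v\hat\otimes E[\sigma]=t^{Nl}\,\mathtt v\hat\otimes E[t\sigma]$. Functions in $\mathfrak m_P$ act by multiplication in the factor $\mathbb W$. $\digamma$ is the one-dimensional space spanned by $du$; evaluation identifies $\digamma$ with $K_z$ for each $z\ne P$, and values at $z$ of forms are regarded as elements of $\digamma$ (so $du_z=du_{z'}$ in $\digamma$). Tensor factors of $\digamma$, $\kappa_z$, $\kappa_{z'}$ are commuted without signs. Fields, for $z\ne P$: $\epsilon(z):\tilde{\mathbb W}\to\tilde{\mathbb W}\otimes\digamma$ is multiplication by $\frac{1}{u-u(z)}\otimes du_z$; $\iota(z):\tilde{\mathbb W}^z\to\tilde{\mathbb W}\otimes\digamma$ is defined by $[\iota(z),\beta]=-d\beta(z)$ for $\beta\in\mathfrak m_P^z$ and $\iota(z)(\mathbf 1\hat\otimes E[\sigma])=-\sqrt N\,\sigma(z)^{-1}\nabla\sigma(z)\,\mathbf 1\hat\otimes E[\sigma]$ for $\sigma$ regular and nonvanishing at $z$; $j(z)=\epsilon(z)+\iota(z)$. For $\lambda=\sqrt N\check\lambda$, $\check\lambda\in\mathbb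 Z$, the field $V_\lambda(z):\tilde{\mathbb W}^z_l\to\tilde{\mathbb W}_{l+\check\lambda}\otimes\kappa_z^{N\check\lambda}\otimes\digamma^{-N\check\lambda(l+\check\lambda)}$ is defined by $$[V_\lambda(z),\beta]=-\lambda\,\beta(z)\,V_\lambda(z)\quad(\beta\in\mathfrak m_P^z),\qquad V_\lambda(z)(\mathbf 1\hat\otimes E[\sigma])=\mathbf 1\hat\otimes E[(u-u(z))^{-\check\lambda}\sigma]\;\sigma(z)^{N\check\lambda}\,du_z^{-N\check\lambda(l+\check\lambda)}$$ for $\sigma\in\mathcal K_l^*(\kappa)^z$. It is independent of the choice of coordinate $u$ and of the representative of $E[\sigma]$. Compositions are taken on vectors built from functions and sections regular (sections also nonvanishing) at both $z$ and $z'$. Note $\lambda\lambda'=N\check\lambda\check\lambda'\in\mathbb Z$. *)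

theory Defs
  imports
    "HOL-Complex_Analysis.Complex_Analysis"
    "HOL-Computational_Algebra.Polynomial_Factorial"
    "HOL-Computational_Algebra.Field_as_Ring"
    "HOL-Library.Poly_Mapping"
    "HOL-Library.Multiset"
    "HOL-Library.FuncSet"
    "HOL-Library.Function_Algebras"
begin

section \<open>Meromorphic functions on the projective line\<close>

text \<open>
  The projective line is \<open>\<complex> \<union> {\<infinity>}\<close> with \<open>P = \<infinity>\<close>, so the points other than \<open>P\<close> are the complex
  numbers. Meromorphic functions are the rational functions in the standard coordinate \<open>x\<close>.
  This \<open>x\<close> only serves to write things down: the coordinate \<open>u\<close> of the vertex operator formulas
  below is arbitrary. The normalised fraction \<open>quot_of_fract f\<close> is coprime with monic denominator.
\<close>

type_synonym mero = "complex poly fract"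

definition const :: "complex \<Rightarrow> mero" where
  "const c = to_fract [:c:]"

definition regular_at :: "mero \<Rightarrow> complex \<Rightarrow> bool" where
  "regular_at f z \<longleftrightarrow> poly (snd (quot_of_fract f)) z \<noteq> 0"

definition mero_eval :: "mero \<Rightarrow> complex \<Rightarrow> complex" where
  "mero_eval f z = poly (fst (quot_of_fract f)) z / poly (snd (quot_of_fract f)) z"

text \<open>The order of vanishing at \<open>P\<close> of a nonzero function.\<close>

definition ord_P :: "mero \<Rightarrow> int" where
  "ord_P f = int (degree (snd (quot_of_fract f))) - int (degree (fst (quot_of_fract f)))"

text \<open>\<open>d f = mero_deriv f \<cdot> dx\<close>.\<close>

definition mero_deriv :: "mero \<Rightarrow> mero" where
  "mero_deriv f = (case quot_of_fract f of (p, q) \<Rightarrow> Fract (pderiv p * q - p * pderiv q) (q\<^sup>2))"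

text \<open>
  The residue at \<open>P\<close> of the form \<open>g dx\<close>: in the local parameter \<open>t = 1/x\<close> at \<open>P\<close> one has
  \<open>g dx = - g(1/t) t\<^sup>-\<^sup>2 dt\<close>.
\<close>

definition residue_P :: "mero \<Rightarrow> complex" where
  "residue_P g = residue (\<lambda>t. - mero_eval g (1 / t) / t\<^sup>2) 0"

definition coordinate :: "mero \<Rightarrow> bool" where
  "coordinate u \<longleftrightarrow> (\<forall>z. regular_at u z) \<and> u \<noteq> 0 \<and> ord_P u = -1"

text \<open>
  \<open>mP Z\<close> is the space of functions that vanish at \<open>P\<close> and are regular at all points of \<open>Z\<close>.
\<close>

definition mP :: "complex set \<Rightarrow> mero set" where
  "mP Z = {f. (f = 0 \<or> ord_P f > 0) \<and> (\<forall>z\<in>Z. regular_at f z)}"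


section \<open>Symmetric algebras\<close>

text \<open>
  The symmetric algebra of the complex vector space \<open>mero\<close>: the free commutative algebra on the set
  of its elements modulo the ideal expressing that the generators depend linearly on the element.
\<close>

type_synonym free_alg = "mero multiset \<Rightarrow>\<^sub>0 complex"

abbreviation free_gen :: "mero \<Rightarrow> free_alg" where
  "free_gen f \<equiv> Poly_Mapping.single {#f#} 1"

abbreviation free_scalar :: "complex \<Rightarrow> free_alg" where
  "free_scalar c \<equiv> Poly_Mapping.single {#} c"

inductive_set sym_ideal :: "free_alg set" where
  gen_add: "free_gen (f + g) - free_gen f - free_gen g \<in> sym_ideal"
| gen_scale: "free_gen (const c * f) - free_scalar c * free_gen f \<in> sym_ideal"
| add: "a \<in> sym_ideal \<Longrightarrow> b \<in> sym_ideal \<Longrightarrow> a + b \<in> sym_ideal"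
| mult: "a \<in> sym_ideal \<Longrightarrow> r * a \<in> sym_ideal"

lemma sym_ideal_0: "0 \<in> sym_ideal"
  using sym_ideal.mult[OF sym_ideal.gen_add[of 0 0], of 0] by simp

lemma sym_ideal_uminus: "a \<in> sym_ideal \<Longrightarrow> - a \<in> sym_ideal"
  using sym_ideal.mult[of a "- 1"] by simp

lemma sym_ideal_diff: "a \<in> sym_ideal \<Longrightarrow> b \<in> sym_ideal \<Longrightarrow> a - b \<in> sym_ideal"
  using sym_ideal.add[OF _ sym_ideal_uminus, of a b] by simp

lemma lookup_mult_empty:
  fixes a b :: free_alg
  shows "Poly_Mapping.lookup (a * b) {#} = Poly_Mapping.lookup a {#} * Poly_Mapping.lookup b {#}"
proof -
  let ?a = "Poly_Mapping.lookup a" and ?b = "Poly_Mapping.lookup b"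
  have 1: "(\<Sum>q. ?b q when {#} = l + q) = (?b {#} when l = {#})" for l :: "mero multiset"
  proof (cases "l = {#}")
    case True
    then have "(\<lambda>q. ?b q when {#} = l + q) = (\<lambda>q. ?b q when q = {#})"
      by (auto simp: when_def fun_eq_iff)
    with True show ?thesis by simp
  next
    case False
    then show ?thesis by (simp add: when_def)
  qed
  have 2: "(\<lambda>l. ?a l * (?b {#} when l = {#})) = (\<lambda>l. (?a l * ?b {#}) when l = {#})"
    by (auto simp: when_def)
  show ?thesis
    unfolding lookup_mult 1 2 by simp
qed

lemma sym_ideal_lookup_empty: "a \<in> sym_ideal \<Longrightarrow> Poly_Mapping.lookup a {#} = 0"
  by (induction rule: sym_ideal.induct)
    (simp_all add: lookup_minus lookup_add lookup_single lookup_mult_empty)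

lemma one_notin_sym_ideal: "1 \<notin> sym_ideal"
  using sym_ideal_lookup_empty[of 1] by (auto simp: lookup_one)

definition sym_rel :: "free_alg \<Rightarrow> free_alg \<Rightarrow> bool" where
  "sym_rel a b \<longleftrightarrow> a - b \<in> sym_ideal"

lemma equivp_sym_rel: "equivp sym_rel"
proof (rule equivpI)
  show "reflp sym_rel"
    by (simp add: reflp_def sym_rel_def sym_ideal_0)
  show "symp sym_rel"
    unfolding symp_def sym_rel_def by (metis minus_diff_eq sym_ideal_uminus)
  show "transp sym_rel"
  proof (rule transpI)
    fix a b c
    assume "sym_rel a b" "sym_rel b c"
    then have "(a - b) + (b - c) \<in> sym_ideal"
      unfolding sym_rel_def by (rule sym_ideal.add)
    then show "sym_rel a c"
      by (simp add: sym_rel_def)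
  qed
qed

quotient_type sym_alg = free_alg / sym_rel
  by (rule equivp_sym_rel)

instantiation sym_alg :: comm_ring_1
begin

lift_definition zero_sym_alg :: sym_alg is 0 .

lift_definition one_sym_alg :: sym_alg is 1 .

lift_definition plus_sym_alg :: "sym_alg \<Rightarrow> sym_alg \<Rightarrow> sym_alg" is "(+)"
  unfolding sym_rel_def by (metis add_diff_add sym_ideal.add)

lift_definition minus_sym_alg :: "sym_alg \<Rightarrow> sym_alg \<Rightarrow> sym_alg" is "(-)"
proof -
  fix a b c d :: free_alg
  assume "sym_rel a b" "sym_rel c d"
  then have "(a - b) - (c - d) \<in> sym_ideal"
    unfolding sym_rel_def by (rule sym_ideal_diff)
  then show "sym_rel (a - c) (b - d)"
    by (simp add: sym_rel_def algebra_simps)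
qed

lift_definition uminus_sym_alg :: "sym_alg \<Rightarrow> sym_alg" is uminus
  unfolding sym_rel_def by (metis minus_diff_minus sym_ideal_uminus)

lift_definition times_sym_alg :: "sym_alg \<Rightarrow> sym_alg \<Rightarrow> sym_alg" is "(*)"
proof -
  fix a b c d :: free_alg
  assume "sym_rel a b" "sym_rel c d"
  then have "c * (a - b) + b * (c - d) \<in> sym_ideal"
    unfolding sym_rel_def by (intro sym_ideal.add sym_ideal.mult)
  then show "sym_rel (a * c) (b * d)"
    by (simp add: sym_rel_def algebra_simps)
qed

instance
proof
  show "(0::sym_alg) \<noteq> 1"
    using sym_ideal_uminus[of "- 1"] one_notin_sym_ideal
    by transfer (auto simp: sym_rel_def)
qed (transfer, simp add: sym_rel_def sym_ideal_0 algebra_simps)+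

end

lift_definition sym_gen :: "mero \<Rightarrow> sym_alg" is free_gen .

lift_definition sym_scalar :: "complex \<Rightarrow> sym_alg" is free_scalar .

text \<open>
  For a linear subspace \<open>M\<close> of \<open>mero\<close> the canonical map from the symmetric algebra of \<open>M\<close> to that of
  \<open>mero\<close> is injective, because a complement exists; the former is identified with its image.
\<close>

inductive_set sym_sub :: "mero set \<Rightarrow> sym_alg set" for M :: "mero set" where
  scalar: "sym_scalar c \<in> sym_sub M"
| gen: "f \<in> M \<Longrightarrow> sym_gen f \<in> sym_sub M"
| add: "a \<in> sym_sub M \<Longrightarrow> b \<in> sym_sub M \<Longrightarrow> a + b \<in> sym_sub M"
| mult: "a \<in> sym_sub M \<Longrightarrow> b \<in> sym_sub M \<Longrightarrow> a * b \<in> sym_sub M"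

text \<open>\<open>\<W>\<close> is \<open>WW {}\<close>, and \<open>\<W>\<^sup>z\<close> is \<open>WW {z}\<close>; the vacuum is \<open>1\<close>.\<close>

definition WW :: "complex set \<Rightarrow> sym_alg set" where
  "WW Z = sym_sub (mP Z)"


section \<open>Sections of the square root of the canonical bundle\<close>

text \<open>
  The meromorphic sections of \<open>\<kappa>\<close> are \<open>\<sigma> = s \<surd>dx\<close> with \<open>s\<close> meromorphic and \<open>\<nabla>\<surd>dx = 0\<close> away from
  \<open>P\<close>; they are represented by \<open>s\<close>. Then \<open>\<nabla>\<sigma> = ds \<otimes> \<surd>dx\<close>, so that \<open>\<sigma>\<^sup>-\<^sup>1 \<nabla>\<sigma>\<close> is the form
  \<open>(mero_deriv s / s) dx\<close>. As \<open>\<surd>dx\<close> has neither zeros nor poles away from \<open>P\<close>, the section is regular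
  or nonvanishing at \<open>z \<noteq> P\<close> if and only if \<open>s\<close> is.

  The one-dimensional spaces \<open>\<kappa>\<^sub>z\<close> and \<open>\<digamma>\<close> have the bases \<open>\<surd>dx(z)\<close> and \<open>dx\<close>. Elements of
  their tensor powers are written as complex numbers with respect to the powers of these bases, so
  that \<open>\<sigma>(z)\<close> becomes \<open>mero_eval s z\<close> and \<open>du\<^sub>z\<close> becomes \<open>mero_eval (mero_deriv u) z\<close>. Accordingly an
  operator with values in the tensor product of a space with such powers becomes an operator
  with values in the space itself.
\<close>

definition log_nabla :: "mero \<Rightarrow> mero" where
  "log_nabla \<sigma> = mero_deriv \<sigma> / \<sigma>"

text \<open>\<open>Ksec Z l\<close>: the sections in \<open>\<K>\<^sup>*\<^sub>l(\<kappa>)\<close> regular and nonvanishing at all points of \<open>Z\<close>.\<close>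

definition Ksec :: "complex set \<Rightarrow> int \<Rightarrow> mero set" where
  "Ksec Z l = {\<sigma>. \<sigma> \<noteq> 0 \<and> residue_P (log_nabla \<sigma>) = of_int l \<and>
                 (\<forall>z\<in>Z. regular_at \<sigma> z \<and> mero_eval \<sigma> z \<noteq> 0)}"


section \<open>The spaces of maps from sections to the symmetric algebra\<close>

type_synonym wt = "mero \<Rightarrow> sym_alg"

definition wt_scale :: "complex \<Rightarrow> wt \<Rightarrow> wt" where
  "wt_scale c \<rho> = (\<lambda>\<sigma>. sym_scalar c * \<rho> \<sigma>)"

definition wt_act :: "mero \<Rightarrow> wt \<Rightarrow> wt" where
  "wt_act \<beta> \<rho> = (\<lambda>\<sigma>. sym_gen \<beta> * \<rho> \<sigma>)"

text \<open>
  \<open>Wt_deg N Z l\<close> is the space of maps \<open>Ksec Z l \<rightarrow> WW Z\<close> of the required homogeneity which are nonzero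
  on finitely many orbits only, extended by zero to all of \<open>mero\<close>. So \<open>\<W>\<close>-tilde in degree \<open>l\<close> is
  \<open>Wt_deg N {} l\<close>, the variant with superscript \<open>z\<close> is \<open>Wt_deg N {z} l\<close>, and \<open>Wt_deg N {z, z'} l\<close>
  consists of the vectors built from data regular at both points.
\<close>

definition Wt_deg :: "nat \<Rightarrow> complex set \<Rightarrow> int \<Rightarrow> wt set" where
  "Wt_deg N Z l = {\<rho>.
     (\<forall>\<sigma>. \<sigma> \<notin> Ksec Z l \<longrightarrow> \<rho> \<sigma> = 0) \<and>
     (\<forall>\<sigma>\<in>Ksec Z l. \<rho> \<sigma> \<in> WW Z) \<and>
     (\<forall>\<sigma>\<in>Ksec Z l. \<forall>t. t \<noteq> 0 \<longrightarrow>
        \<rho> (const t * \<sigma>) = sym_scalar (t powi (int N * l)) * \<rho> \<sigma>) \<and>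
     finite ((\<lambda>\<sigma>. {const t * \<sigma> | t. t \<noteq> 0}) ` {\<sigma>. \<rho> \<sigma> \<noteq> 0})}"

text \<open>
  Since the sets \<open>Ksec Z l\<close> for different \<open>l\<close> are disjoint, the direct sum over \<open>l\<close> is the internal
  sum of the \<open>Wt_deg N Z l\<close> inside the space of all functions.
\<close>

definition Wt :: "nat \<Rightarrow> complex set \<Rightarrow> wt set" where
  "Wt N Z = {\<rho>. \<exists>L r. finite L \<and> (\<forall>l\<in>L. r l \<in> Wt_deg N Z l) \<and> \<rho> = (\<Sum>l\<in>L. r l)}"

text \<open>\<open>vecE N l v \<sigma>\<close> is \<open>v\<close> tensor \<open>E[\<sigma>]\<close> for \<open>\<sigma>\<close> of degree \<open>l\<close>.\<close>

definition vecE :: "nat \<Rightarrow> int \<Rightarrow> sym_alg \<Rightarrow> mero \<Rightarrow> wt" where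
  "vecE N l v \<sigma> = (\<lambda>\<tau>. if \<exists>t. t \<noteq> 0 \<and> \<tau> = const t * \<sigma>
     then sym_scalar ((THE t. t \<noteq> 0 \<and> \<tau> = const t * \<sigma>) powi (int N * l)) * v
     else 0)"

definition linear_on_wt :: "wt set \<Rightarrow> (wt \<Rightarrow> wt) \<Rightarrow> bool" where
  "linear_on_wt D A \<longleftrightarrow>
     (\<forall>\<rho>\<in>D. \<forall>\<tau>\<in>D. A (\<rho> + \<tau>) = A \<rho> + A \<tau>) \<and>
     (\<forall>c. \<forall>\<rho>\<in>D. A (wt_scale c \<rho>) = wt_scale c (A \<rho>))"


section \<open>Fields\<close>

definition du_at :: "mero \<Rightarrow> complex \<Rightarrow> complex" where
  "du_at u z = mero_eval (mero_deriv u) z"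

definition eps_field :: "mero \<Rightarrow> complex \<Rightarrow> wt \<Rightarrow> wt" where
  "eps_field u z \<rho> = wt_scale (du_at u z) (wt_act (1 / (u - const (mero_eval u z))) \<rho>)"

text \<open>
  The next two operators are determined by their commutators with functions and their values on the
  vectors \<open>\<one> \<otimes> E[\<sigma>]\<close>. Membership in the extensional function space fixes the (irrelevant)
  values outside of the domain \<open>Wt N {z}\<close>, so that the description is unique.
\<close>

definition iota_field :: "nat \<Rightarrow> complex \<Rightarrow> wt \<Rightarrow> wt" where
  "iota_field N z = (THE A. A \<in> Wt N {z} \<rightarrow>\<^sub>E Wt N {} \<and> linear_on_wt (Wt N {z}) A \<and>
     (\<forall>\<beta>\<in>mP {z}. \<forall>\<rho>\<in>Wt N {z}.
        A (wt_act \<beta> \<rho>) - wt_act \<beta> (A \<rho>) = wt_scale (- mero_eval (mero_deriv \<beta>) z) \<rho>) \<and>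
     (\<forall>l. \<forall>\<sigma>\<in>Ksec {z} l.
        A (vecE N l 1 \<sigma>) =
          wt_scale (- (of_real (sqrt (real N)) * mero_eval (log_nabla \<sigma>) z)) (vecE N l 1 \<sigma>)))"

definition j_field :: "nat \<Rightarrow> mero \<Rightarrow> complex \<Rightarrow> wt \<Rightarrow> wt" where
  "j_field N u z \<rho> = eps_field u z \<rho> + iota_field N z \<rho>"

text \<open>\<open>V_field N u c z\<close> is \<open>V\<^sub>\<lambda>(z)\<close> for \<open>\<lambda> = \<surd>N c\<close>, written with the coordinate \<open>u\<close>.\<close>

definition V_field :: "nat \<Rightarrow> mero \<Rightarrow> int \<Rightarrow> complex \<Rightarrow> wt \<Rightarrow> wt" where
  "V_field N u c z = (THE A. A \<in> Wt N {z} \<rightarrow>\<^sub>E Wt N {} \<and> linear_on_wt (Wt N {z}) A \<and>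
     (\<forall>l. \<forall>\<rho>\<in>Wt_deg N {z} l. A \<rho> \<in> Wt_deg N {} (l + c)) \<and>
     (\<forall>\<beta>\<in>mP {z}. \<forall>\<rho>\<in>Wt N {z}.
        A (wt_act \<beta> \<rho>) - wt_act \<beta> (A \<rho>) =
          wt_scale (- (of_real (sqrt (real N) * of_int c) * mero_eval \<beta> z)) (A \<rho>)) \<and>
     (\<forall>l. \<forall>\<sigma>\<in>Ksec {z} l.
        A (vecE N l 1 \<sigma>) =
          wt_scale (mero_eval \<sigma> z powi (int N * c) * du_at u z powi (- (int N * c * (l + c))))
            (vecE N (l + c) 1 ((u - const (mero_eval u z)) powi (- c) * \<sigma>))))"

end

theory Submission
  imports
    Defs
    "HOL-Computational_Algebra.Fundamental_Theorem_Algebra"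
begin

text \<open>
  The residue of \<open>\<sigma>\<^sup>-\<^sup>1 \<nabla>\<sigma>\<close> at \<open>P\<close> is the order of \<open>\<sigma>\<close> there, so the vectors are spanned by products of
  functions with the \<open>\<one> \<otimes> E[\<sigma>]\<close>, and the fields are uniquely determined by their commutators with
  functions and their values on the \<open>\<one> \<otimes> E[\<sigma>]\<close>. They exist because they have a closed form: on
  the symmetric algebra, \<open>V\<^sub>\<lambda>(z)\<close> acts by the homomorphism \<open>\<beta> \<mapsto> \<beta> - \<lambda> \<beta>(z)\<close> and \<open>\<iota>(z)\<close> by the
  derivation \<open>\<beta> \<mapsto> - \<beta>'(z)\<close>, up to scalars depending on \<open>\<sigma>\<close>. To define these on the symmetric
  algebra of all functions, \<open>\<beta> \<mapsto> \<beta>(z)\<close> and \<open>\<beta> \<mapsto> \<beta>'(z)\<close> are extended arbitrarily to linear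
  functionals. These homomorphisms and derivations commute, so only the scalars have to be compared.
  The sign is that of \<open>(u(z') - u(z))\<close> to the power \<open>-\<lambda>\<lambda>'\<close> against the same power of
  \<open>(u(z) - u(z'))\<close>; for \<open>j\<close>, the shift of \<open>1/(u - u(z'))\<close> by its value at \<open>z\<close> cancels the logarithmic
  derivative at \<open>z'\<close> of \<open>u - u(z)\<close> to the power \<open>-\<lambda>/\<surd>N\<close>.
\<close>


section \<open>Rational functions\<close>

lemma mero_rep:
  obtains p q where "f = Fract p q" "q \<noteq> 0" "coprime p q" "quot_of_fract f = (p, q)"
  using that Fract_quot_of_fract[of f] coprime_quot_of_fract[of f] snd_quot_of_fract_nonzero[of f]
  by (metis surjective_pairing)

text \<open>Cross-multiplying with the reduced fraction gives \<open>p * q0 = p0 * q\<close>, so a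
  zero of \<open>q0\<close> at \<open>z\<close> would force a zero of \<open>p0\<close> there,
  against coprimality. Hence any representative whose denominator is nonzero at \<open>z\<close> can
  be used to compute values.\<close>

lemma regular_Fract:
  assumes "poly q z \<noteq> 0"
  shows "regular_at (Fract p q) z" "mero_eval (Fract p q) z = poly p z / poly q z"
proof -
  obtain p0 q0 where r: "Fract p q = Fract p0 q0" "q0 \<noteq> 0" "coprime p0 q0"
    "quot_of_fract (Fract p q) = (p0, q0)"
    using mero_rep by blast
  have "q \<noteq> 0" using assms by auto
  then have "p * q0 = p0 * q"
    using r by (simp add: eq_fract)
  then have eq: "poly p z * poly q0 z = poly p0 z * poly q z"
    by (metis poly_mult)
  have "poly q0 z \<noteq> 0"
    using r(3) eq assms coprime_poly_0[of p0 q0 z] by auto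
  then show "regular_at (Fract p q) z" "mero_eval (Fract p q) z = poly p z / poly q z"
    using eq assms by (auto simp: regular_at_def mero_eval_def r(4) field_simps)
qed

lemma regular_rep:
  assumes "regular_at f z"
  obtains p q where "f = Fract p q" "poly q z \<noteq> 0" "mero_eval f z = poly p z / poly q z"
  using assms that[of "fst (quot_of_fract f)" "snd (quot_of_fract f)"]
  unfolding regular_at_def mero_eval_def Fract_quot_of_fract by blast

lemma nz_poly: "poly q z \<noteq> 0 \<Longrightarrow> q \<noteq> 0" by auto

lemma regular_add:
  assumes "regular_at f z" "regular_at g z"
  shows "regular_at (f + g) z" "mero_eval (f + g) z = mero_eval f z + mero_eval g z"
proof -
  obtain p q where 1: "f = Fract p q" "poly q z \<noteq> 0" "mero_eval f z = poly p z / poly q z"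
    using regular_rep[OF assms(1)] by blast
  obtain p' q' where 2: "g = Fract p' q'" "poly q' z \<noteq> 0" "mero_eval g z = poly p' z / poly q' z"
    using regular_rep[OF assms(2)] by blast
  have "f + g = Fract (p * q' + p' * q) (q * q')"
    unfolding 1(1) 2(1) by (rule add_fract) (use 1 2 in auto)
  then show "regular_at (f + g) z" "mero_eval (f + g) z = mero_eval f z + mero_eval g z"
    using regular_Fract[of "q * q'" z "p * q' + p' * q"] 1 2 by (simp_all add: add_frac_eq)
qed

lemma regular_mult:
  assumes "regular_at f z" "regular_at g z"
  shows "regular_at (f * g) z" "mero_eval (f * g) z = mero_eval f z * mero_eval g z"
proof -
  obtain p q where 1: "f = Fract p q" "poly q z \<noteq> 0" "mero_eval f z = poly p z / poly q z"
    using regular_rep[OF assms(1)] by blast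
  obtain p' q' where 2: "g = Fract p' q'" "poly q' z \<noteq> 0" "mero_eval g z = poly p' z / poly q' z"
    using regular_rep[OF assms(2)] by blast
  have "f * g = Fract (p * p') (q * q')"
    unfolding 1(1) 2(1) by (rule mult_fract)
  then show "regular_at (f * g) z" "mero_eval (f * g) z = mero_eval f z * mero_eval g z"
    using regular_Fract[of "q * q'" z "p * p'"] 1 2 by simp_all
qed

lemma const_Fract: "const c = Fract [:c:] 1"
  by (simp add: const_def to_fract_def)

lemma regular_const [simp]: "regular_at (const c) z" "mero_eval (const c) z = c"
  using regular_Fract[of 1 z "[:c:]"] by (auto simp: const_Fract)

lemma const_0 [simp]: "const 0 = 0" and const_1 [simp]: "const 1 = 1"
  by (simp_all add: const_def one_pCons flip: to_fract_1)

lemma const_eq_0_iff [simp]: "const c = 0 \<longleftrightarrow> c = 0"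
  by (simp add: const_def)

lemma const_add: "const (c + d) = const c + const d"
  by (simp add: const_def flip: to_fract_add)

lemma const_mult: "const (c * d) = const c * const d"
  by (simp add: const_def flip: to_fract_mult)

lemma const_inject [simp]: "const c = const d \<longleftrightarrow> c = d"
  by (simp add: const_def)

definition unit_at :: "mero \<Rightarrow> complex \<Rightarrow> bool" where
  "unit_at f z \<longleftrightarrow> regular_at f z \<and> mero_eval f z \<noteq> 0"

lemma unit_at_mult: "unit_at f z \<Longrightarrow> unit_at g z \<Longrightarrow> unit_at (f * g) z"
  by (simp add: unit_at_def regular_mult)

lemma unit_at_const: "c \<noteq> 0 \<Longrightarrow> unit_at (const c) z"
  by (simp add: unit_at_def)

lemma unit_at_inverse:
  assumes "unit_at f z"
  shows "unit_at (inverse f) z" "mero_eval (inverse f) z = inverse (mero_eval f z)"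
proof -
  obtain p q where 1: "f = Fract p q" "poly q z \<noteq> 0" "mero_eval f z = poly p z / poly q z"
    using assms regular_rep[of f z] by (auto simp: unit_at_def)
  with assms have "poly p z \<noteq> 0" by (auto simp: unit_at_def)
  then show "unit_at (inverse f) z" "mero_eval (inverse f) z = inverse (mero_eval f z)"
    using regular_Fract[of p z q] 1 unfolding unit_at_def by auto
qed

lemma unit_at_power:
  assumes "unit_at f z"
  shows "unit_at (f ^ n) z \<and> mero_eval (f ^ n) z = mero_eval f z ^ n"
proof (induction n)
  case 0
  then show ?case using regular_const[of 1 z] by (simp add: unit_at_def)
next
  case (Suc n)
  then show ?case using assms by (auto simp: unit_at_def regular_mult)
qed

lemma unit_at_powi:
  assumes "unit_at f z"
  shows "unit_at (f powi n) z" "mero_eval (f powi n) z = mero_eval f z powi n"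
  using unit_at_power[OF assms, of "nat n"] unit_at_inverse[OF assms]
    unit_at_power[of "inverse f" z "nat (- n)"]
  by (auto simp: power_int_def)

lemma unit_at_nonzero: "unit_at f z \<Longrightarrow> f \<noteq> 0"
  using regular_const[of 0 z] by (auto simp: unit_at_def)

subsection \<open>Derivatives\<close>

text \<open>Differentiating \<open>p * q0 = p0 * q\<close> shows that the quotient rule does not
  depend on the representative.\<close>

lemma mero_deriv_Fract:
  assumes "q \<noteq> 0"
  shows "mero_deriv (Fract p q) = Fract (pderiv p * q - p * pderiv q) (q\<^sup>2)"
proof -
  obtain p0 q0 where r: "Fract p q = Fract p0 q0" "q0 \<noteq> 0" "coprime p0 q0"
    "quot_of_fract (Fract p q) = (p0, q0)"
    using mero_rep by blast
  have e: "p * q0 = p0 * q"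
    using r assms by (simp add: eq_fract)
  from arg_cong[OF e, of pderiv]
  have e': "pderiv p * q0 + p * pderiv q0 = pderiv p0 * q + p0 * pderiv q"
    by (simp add: pderiv_mult algebra_simps)
  have "(pderiv p0 * q0 - p0 * pderiv q0) * q\<^sup>2 = (pderiv p * q - p * pderiv q) * q0\<^sup>2"
    using e e' by algebra
  then show ?thesis
    using assms r(2) by (simp add: mero_deriv_def r(4) eq_fract)
qed

lemma mero_deriv_add: "mero_deriv (f + g) = mero_deriv f + mero_deriv g"
proof -
  obtain p q where 1: "f = Fract p q" "q \<noteq> 0" using mero_rep[of f] by metis
  obtain p' q' where 2: "g = Fract p' q'" "q' \<noteq> 0" using mero_rep[of g] by metis
  have "(pderiv (p * q' + p' * q) * (q * q') - (p * q' + p' * q) * pderiv (q * q')) * (q\<^sup>2 * q'\<^sup>2) =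
      ((pderiv p * q - p * pderiv q) * q'\<^sup>2 + (pderiv p' * q' - p' * pderiv q') * q\<^sup>2) * (q * q')\<^sup>2"
    unfolding pderiv_mult pderiv_add by algebra
  then show ?thesis
    unfolding 1 2 using 1(2) 2(2) by (simp add: mero_deriv_Fract eq_fract)
qed

lemma mero_deriv_mult: "mero_deriv (f * g) = mero_deriv f * g + f * mero_deriv g"
proof -
  obtain p q where 1: "f = Fract p q" "q \<noteq> 0" using mero_rep[of f] by metis
  obtain p' q' where 2: "g = Fract p' q'" "q' \<noteq> 0" using mero_rep[of g] by metis
  have "(pderiv (p * p') * (q * q') - p * p' * pderiv (q * q')) * ((q\<^sup>2 * q') * (q * q'\<^sup>2)) =
      ((pderiv p * q - p * pderiv q) * p' * (q * q'\<^sup>2) + p * (pderiv p' * q' - p' * pderiv q') * (q\<^sup>2 * q'))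
        * (q * q')\<^sup>2"
    unfolding pderiv_mult by algebra
  then show ?thesis
    unfolding 1 2 using 1(2) 2(2) by (simp add: mero_deriv_Fract eq_fract)
qed

lemma mero_deriv_const [simp]: "mero_deriv (const c) = 0"
  by (simp add: const_Fract mero_deriv_Fract pderiv_pCons fract_collapse)

lemma regular_deriv:
  assumes "regular_at f z"
  shows "regular_at (mero_deriv f) z"
proof -
  obtain p q where 1: "f = Fract p q" "poly q z \<noteq> 0"
    using regular_rep[OF assms(1)] by blast
  then show ?thesis
    by (auto simp: mero_deriv_Fract[OF nz_poly] intro!: regular_Fract)
qed

lemma log_nabla_mult:
  "f \<noteq> 0 \<Longrightarrow> g \<noteq> 0 \<Longrightarrow> log_nabla (f * g) = log_nabla f + log_nabla g"
  by (simp add: log_nabla_def mero_deriv_mult field_simps)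

lemma log_nabla_const [simp]: "log_nabla (const c) = 0"
  by (simp add: log_nabla_def)

lemma log_nabla_1 [simp]: "log_nabla 1 = 0"
  using log_nabla_const[of 1] by (simp del: log_nabla_const)

lemma log_nabla_inverse: "f \<noteq> 0 \<Longrightarrow> log_nabla (inverse f) = - log_nabla f"
  using log_nabla_mult[of f "inverse f"] by (simp add: eq_neg_iff_add_eq_0 add.commute)

lemma log_nabla_power: "f \<noteq> 0 \<Longrightarrow> log_nabla (f ^ n) = of_nat n * log_nabla f"
  by (induction n) (simp_all add: log_nabla_mult algebra_simps)

lemma log_nabla_powi: "f \<noteq> 0 \<Longrightarrow> log_nabla (f powi n) = of_int n * log_nabla f"
  by (auto simp: power_int_def log_nabla_power log_nabla_inverse)

lemma of_nat_const: "of_nat n = const (of_nat n)"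
  by (induction n) (simp_all add: const_add)

lemma const_uminus: "const (- c) = - const c"
  using const_add[of c "- c"] by (simp add: eq_neg_iff_add_eq_0 add.commute)

lemma of_int_const: "of_int n = const (of_int n)"
proof (cases n)
  case (neg m)
  then show ?thesis
    by (simp only: of_int_minus of_int_of_nat_eq of_nat_const const_uminus)
qed (simp add: of_nat_const)

lemma log_nabla_regular:
  assumes "unit_at f z"
  shows "regular_at (log_nabla f) z"
    "mero_eval (log_nabla f) z = mero_eval (mero_deriv f) z / mero_eval f z"
  using regular_mult[of "mero_deriv f" z "inverse f"] unit_at_inverse[OF assms]
    regular_deriv[of f z] assms
  by (auto simp: log_nabla_def unit_at_def field_simps)

subsection \<open>The order at \<open>P\<close>\<close>

text \<open>Taking degrees in \<open>p * q0 = p0 * q\<close> shows that cancelling common factors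
  leaves the difference of degrees unchanged.\<close>

lemma ord_P_Fract:
  assumes "p \<noteq> 0" "q \<noteq> 0"
  shows "ord_P (Fract p q) = int (degree q) - int (degree p)"
proof -
  obtain p0 q0 where r: "Fract p q = Fract p0 q0" "q0 \<noteq> 0" "coprime p0 q0"
    "quot_of_fract (Fract p q) = (p0, q0)"
    using mero_rep by blast
  have e: "p * q0 = p0 * q"
    using r assms by (simp add: eq_fract)
  then have "p0 \<noteq> 0" using assms r(2) by auto
  from arg_cong[OF e, of degree] have "degree p + degree q0 = degree p0 + degree q"
    using assms r(2) \<open>p0 \<noteq> 0\<close> by (simp add: degree_mult_eq)
  then show ?thesis by (simp add: ord_P_def r(4))
qed

lemma nonzero_rep:
  fixes f :: mero
  assumes "f \<noteq> 0"
  obtains p q where "f = Fract p q" "p \<noteq> 0" "q \<noteq> 0"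
  using mero_rep[of f] assms by (metis eq_fract(3) Zero_fract_def fract_collapse(1))

lemma ord_P_mult:
  assumes "f \<noteq> 0" "g \<noteq> 0"
  shows "ord_P (f * g) = ord_P f + ord_P g"
proof -
  obtain p q where 1: "f = Fract p q" "p \<noteq> 0" "q \<noteq> 0" using nonzero_rep[OF assms(1)] by blast
  obtain p' q' where 2: "g = Fract p' q'" "p' \<noteq> 0" "q' \<noteq> 0" using nonzero_rep[OF assms(2)] by blast
  show ?thesis
    unfolding 1 2 using 1(2,3) 2(2,3) by (simp add: ord_P_Fract degree_mult_eq)
qed

lemma ord_P_const [simp]: "c \<noteq> 0 \<Longrightarrow> ord_P (const c) = 0"
  by (simp add: const_Fract ord_P_Fract)

lemma ord_P_1 [simp]: "ord_P 1 = 0"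
  using ord_P_const[of 1] by (simp del: ord_P_const)

lemma ord_P_inverse: "f \<noteq> 0 \<Longrightarrow> ord_P (inverse f) = - ord_P f"
  using ord_P_mult[of f "inverse f"] by simp

lemma ord_P_power: "f \<noteq> 0 \<Longrightarrow> ord_P (f ^ n) = int n * ord_P f"
  by (induction n) (simp_all add: ord_P_mult algebra_simps)

lemma ord_P_powi: "f \<noteq> 0 \<Longrightarrow> ord_P (f powi n) = n * ord_P f"
  by (auto simp: power_int_def ord_P_power ord_P_inverse)

lemma ord_P_const_mult [simp]: "c \<noteq> 0 \<Longrightarrow> f \<noteq> 0 \<Longrightarrow> ord_P (const c * f) = ord_P f"
  by (simp add: ord_P_mult)


section \<open>Residue of the logarithmic derivative at \<open>P\<close>\<close>

lemma log_nabla_Fract: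
  assumes "p \<noteq> 0" "q \<noteq> 0"
  shows "log_nabla (Fract p q) = Fract (pderiv p * q - p * pderiv q) (p * q)"
proof -
  have "(pderiv p * q - p * pderiv q) * q * (p * q) = (pderiv p * q - p * pderiv q) * (q\<^sup>2 * p)"
    by (simp add: power2_eq_square mult_ac)
  then show ?thesis
    using assms by (simp add: log_nabla_def mero_deriv_Fract eq_fract)
qed

text \<open>Logarithmic differentiation of \<open>t ^ degree p * poly p (1 / t)\<close>, which is
  the reflected polynomial. It carries logarithmic derivatives at \<open>x = 1 / t\<close> over to
  the local parameter at \<open>P\<close>.\<close>

lemma log_deriv_reflect_poly:
  fixes p :: "complex poly"
  assumes "t \<noteq> 0" "poly p (1 / t) \<noteq> 0"
  shows "poly (pderiv (reflect_poly p)) t / poly (reflect_poly p) t =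
    of_nat (degree p) / t - poly (pderiv p) (1 / t) / (t\<^sup>2 * poly p (1 / t))"
proof -
  have "((\<lambda>t. t ^ degree p * poly p (inverse t)) has_field_derivative
      (of_nat (degree p) * t ^ (degree p - 1) * poly p (inverse t)
       - t ^ degree p * poly (pderiv p) (inverse t) / t\<^sup>2)) (at t)"
    using assms(1)
    by (auto intro!: derivative_eq_intros DERIV_chain2[OF poly_DERIV]
        simp: power2_eq_square field_simps)
  then have "((poly (reflect_poly p)) has_field_derivative
      (of_nat (degree p) * t ^ (degree p - 1) * poly p (inverse t)
       - t ^ degree p * poly (pderiv p) (inverse t) / t\<^sup>2)) (at t)"
    by (rule has_field_derivative_transform_within_open[where S = "- {0}"])
      (use assms(1) in \<open>auto simp: poly_reflect_poly_nz\<close>)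
  then have "poly (pderiv (reflect_poly p)) t =
     of_nat (degree p) * t ^ (degree p - 1) * poly p (inverse t)
       - t ^ degree p * poly (pderiv p) (inverse t) / t\<^sup>2"
    using DERIV_unique poly_DERIV by blast
  \<comment> \<open>For constant \<open>p\<close> the exponent \<open>degree p - 1\<close> is
    truncated to 0, but then the factor \<open>degree p\<close> vanishes.\<close>
  moreover have "of_nat (degree p) * t ^ (degree p - 1) = of_nat (degree p) * t ^ degree p / t"
    using assms(1) by (cases "degree p") auto
  ultimately show ?thesis
    using assms by (simp add: poly_reflect_poly_nz inverse_eq_divide diff_divide_distrib)
qed

text \<open>In the parameter \<open>t\<close>, \<open>f\<close> is \<open>t\<close> to the power
  \<open>ord_P f\<close> times the quotient of the reflected polynomials, whose values at 0 are the
  leading coefficients of \<open>p\<close> and \<open>q\<close>, hence nonzero. So the logarithmic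
  derivative has at most a simple pole at \<open>t = 0\<close>, with the order as residue.\<close>

lemma residue_P_log_nabla:
  assumes "f \<noteq> 0"
  shows "residue_P (log_nabla f) = of_int (ord_P f)"
proof -
  obtain p q where f: "f = Fract p q" "p \<noteq> 0" "q \<noteq> 0" using nonzero_rep[OF assms] by blast
  let ?p = "reflect_poly p" and ?q = "reflect_poly q"
  define S where "S = {t. poly ?p t \<noteq> 0 \<and> poly ?q t \<noteq> 0}"
  \<comment> \<open>\<open>G\<close> is \<open>t\<close> times the coefficient of the form,
    continued holomorphically to \<open>t = 0\<close>; the residue is then
    \<open>G 0\<close>.\<close>
  define G where "G = (\<lambda>t. of_int (ord_P f) +
    t * (poly (pderiv ?p) t / poly ?p t - poly (pderiv ?q) t / poly ?q t))"
  have "open S"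
    unfolding S_def by (intro open_Collect_conj open_Collect_neq continuous_intros)
  have "0 \<in> S" using f by (auto simp: S_def)
  have "G holomorphic_on S"
    unfolding G_def S_def by (intro holomorphic_intros) auto
  have "residue_P (log_nabla f) = residue (\<lambda>t. G t / (t - 0)) 0"
    unfolding residue_P_def
  proof (rule residue_cong)
    have "eventually (\<lambda>t. t \<in> S - {0}) (at 0)"
      using eventually_at_in_open[OF \<open>open S\<close> \<open>0 \<in> S\<close>] .
    then show "\<forall>\<^sub>F t in at 0. - mero_eval (log_nabla f) (1 / t) / t\<^sup>2 = G t / (t - 0)"
    proof eventually_elim
      case (elim t)
      then have t: "t \<noteq> 0" "poly p (1 / t) \<noteq> 0" "poly q (1 / t) \<noteq> 0"
        by (auto simp: S_def poly_reflect_poly_nz inverse_eq_divide)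
      have "mero_eval (log_nabla f) (1 / t) =
          poly (pderiv p) (1 / t) / poly p (1 / t) - poly (pderiv q) (1 / t) / poly q (1 / t)"
        unfolding f(1) log_nabla_Fract[OF f(2,3)] using t
        by (subst regular_Fract(2)) (auto simp: field_simps)
      then show ?case
        unfolding G_def log_deriv_reflect_poly[OF t(1,2)] log_deriv_reflect_poly[OF t(1,3)]
        using t by (simp add: f(1) ord_P_Fract[OF f(2,3)]) (simp add: field_simps power2_eq_square)
    qed
  qed simp
  also have "\<dots> = G 0"
    by (rule residue_simple) fact+
  finally show ?thesis by (simp add: G_def)
qed

lemma Ksec_iff: "\<sigma> \<in> Ksec Z l \<longleftrightarrow> \<sigma> \<noteq> 0 \<and> ord_P \<sigma> = l \<and> (\<forall>z\<in>Z. unit_at \<sigma> z)"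
  by (auto simp: Ksec_def residue_P_log_nabla unit_at_def)

subsection \<open>Coordinates\<close>

text \<open>A denominator without zeros in the plane is constant by the fundamental theorem of
  algebra, and a simple pole at \<open>P\<close> leaves degree one for the numerator.\<close>

lemma coordinate_rep:
  assumes "coordinate u"
  obtains a b where "a \<noteq> 0" "u = Fract [:b, a:] 1"
proof -
  obtain p q where r: "u = Fract p q" "q \<noteq> 0" "coprime p q" "quot_of_fract u = (p, q)"
    using mero_rep[of u] by metis
  have "\<forall>z. poly q z \<noteq> 0"
    using assms r(4) by (auto simp: coordinate_def regular_at_def)
  then have "constant (poly q)"
    using Fundamental_Theorem_Algebra.fundamental_theorem_of_algebra[of q] by auto
  then obtain d where d: "q = [:d:]"
    by (metis constant_degree degree_eq_zeroE)
  with r(2) have "d \<noteq> 0" by simp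
  have "degree p = 1"
    using assms r d by (auto simp: coordinate_def ord_P_def)
  then have "p = [:coeff p 0, coeff p 1:]" and "coeff p 1 \<noteq> 0"
    by (auto simp: poly_eq_iff coeff_pCons coeff_eq_0 split: nat.split)
      (metis \<open>degree p = 1\<close> leading_coeff_neq_0 One_nat_def degree_0 zero_neq_one)
  then obtain a b where p: "p = [:b, a:]" "a \<noteq> 0"
    by blast
  then have "u = Fract [:b / d, a / d:] 1"
    unfolding r(1) d using \<open>d \<noteq> 0\<close> by (simp add: eq_fract)
  with that[of "a / d" "b / d"] p(2) \<open>d \<noteq> 0\<close> show ?thesis by simp
qed

locale coord =
  fixes u :: mero
  assumes coordinate: "coordinate u"
begin

abbreviation w :: "complex \<Rightarrow> mero" where "w z \<equiv> u - const (mero_eval u z)"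

text \<open>With \<open>u = a x + b\<close> one has \<open>w z = a (x - z)\<close>, and
  \<open>du_at u\<close> is the constant \<open>a\<close>. This constancy is what makes the values
  of \<open>du\<close> at different points comparable.\<close>

lemma w_simps:
  "regular_at (w z) z'" "mero_eval (w z) z' = du_at u z * (z' - z)"
  "w z \<noteq> 0" "ord_P (w z) = -1" "mero_deriv (w z) = const (du_at u z)"
  "du_at u z \<noteq> 0" "du_at u z' = du_at u z"
proof -
  obtain a b where ab: "a \<noteq> 0" "u = Fract [:b, a:] 1" by (rule coordinate_rep[OF coordinate])
  have 1: "mero_eval u z = b + a * z" for z
    unfolding ab(2) by (subst regular_Fract) (auto simp: mult.commute)
  have 2: "mero_deriv u = const a"
    unfolding ab(2) by (simp add: mero_deriv_Fract const_Fract pderiv_pCons)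
  have 3: "w z = Fract [:- a * z, a:] 1" for z
    unfolding 1 by (simp add: ab(2) const_Fract eq_fract)
  have 4: "du_at u z = a" for z
    by (simp add: du_at_def 2)
  have "regular_at (Fract [:- a * z, a:] 1) z'" "mero_eval (Fract [:- a * z, a:] 1) z' = a * (z' - z)"
    using regular_Fract[of 1 z' "[:- a * z, a:]"] by (simp_all add: algebra_simps)
  then show "regular_at (w z) z'" "mero_eval (w z) z' = du_at u z * (z' - z)"
    by (simp_all only: 3 4)
  show "w z \<noteq> 0" "ord_P (w z) = -1"
    unfolding 3 using ab(1) by (simp_all add: ord_P_Fract Zero_fract_def eq_fract)
  show "mero_deriv (w z) = const (du_at u z)"
    unfolding 3 4 by (simp add: mero_deriv_Fract const_Fract pderiv_pCons)
  show "du_at u z \<noteq> 0" "du_at u z' = du_at u z"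
    by (simp_all only: 4 ab(1) not_False_eq_True)
qed

lemma unit_at_w: "z \<noteq> z' \<Longrightarrow> unit_at (w z) z'"
  using w_simps(1,2)[of z z'] w_simps(6)[of z] by (simp add: unit_at_def)

text \<open>The simple pole of \<open>w z\<close> at \<open>P\<close> becomes a zero of the inverse,
  and the only zero of \<open>w z\<close> is at \<open>z\<close>.\<close>

lemma inverse_w_mP: "z \<notin> Z \<Longrightarrow> 1 / w z \<in> mP Z"
  using w_simps(3,4)[of z] unit_at_inverse(1)[OF unit_at_w[of z]]
  by (fastforce simp: mP_def divide_inverse ord_P_inverse unit_at_def)

end

subsection \<open>Extension of evaluation and derivative at a point to linear functionals\<close>

interpretation mero_vs: vector_space "\<lambda>c (f::mero). const c * f"
  by standard (simp_all add: algebra_simps const_add const_mult)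

lemma subspace_regular: "mero_vs.subspace {f. regular_at f z}"
  using regular_const[of 0 z]
  by (auto simp: mero_vs.subspace_def intro!: regular_add regular_mult)

text \<open>The inclusion of the subspace of functions regular at \<open>z\<close> has a linear left
  inverse. Composing it with the value or the derivative at \<open>z\<close> yields functionals
  defined on all of \<open>mero\<close>.\<close>

lemma regular_projection_exists:
  "\<exists>\<pi>. (\<forall>f. regular_at (\<pi> f) z) \<and> (\<forall>f g. \<pi> (f + g) = \<pi> f + \<pi> g) \<and>
     (\<forall>c f. \<pi> (const c * f) = const c * \<pi> f) \<and> (\<forall>f. regular_at f z \<longrightarrow> \<pi> f = f)"
proof -
  interpret vector_space_pair "\<lambda>c (f::mero). const c * f" "\<lambda>c (f::mero). const c * f" ..
  have "Vector_Spaces.linear (\<lambda>c (f::mero). const c * f) (\<lambda>c (f::mero). const c * f) (\<lambda>f. f)"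
    by (rule mero_vs.linear_ident)
  from linear_exists_left_inverse_on[OF this subspace_regular[of z] inj_on_id2]
  obtain g where g: "range g \<subseteq> {f. regular_at f z}"
    "Vector_Spaces.linear (\<lambda>c (f::mero). const c * f) (\<lambda>c (f::mero). const c * f) g"
    "\<forall>f\<in>{f. regular_at f z}. g f = f"
    by blast
  then show ?thesis
    using linear_add[OF g(2)] linear_scale[OF g(2)] by (intro exI[of _ g]) auto
qed

definition regular_projection :: "complex \<Rightarrow> mero \<Rightarrow> mero" where
  "regular_projection z = (SOME \<pi>. (\<forall>f. regular_at (\<pi> f) z) \<and> (\<forall>f g. \<pi> (f + g) = \<pi> f + \<pi> g) \<and>
     (\<forall>c f. \<pi> (const c * f) = const c * \<pi> f) \<and> (\<forall>f. regular_at f z \<longrightarrow> \<pi> f = f))"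

lemma regular_projection:
  "regular_at (regular_projection z f) z"
  "regular_projection z (f + g) = regular_projection z f + regular_projection z g"
  "regular_projection z (const c * f) = const c * regular_projection z f"
  "regular_at f z \<Longrightarrow> regular_projection z f = f"
  using someI_ex[OF regular_projection_exists[of z]] unfolding regular_projection_def by blast+

definition eval_ext :: "complex \<Rightarrow> mero \<Rightarrow> complex" where
  "eval_ext z f = mero_eval (regular_projection z f) z"

definition deriv_ext :: "complex \<Rightarrow> mero \<Rightarrow> complex" where
  "deriv_ext z f = mero_eval (mero_deriv (regular_projection z f)) z"

lemma eval_ext:
  "eval_ext z (f + g) = eval_ext z f + eval_ext z g"
  "eval_ext z (const c * f) = c * eval_ext z f"
  "regular_at f z \<Longrightarrow> eval_ext z f = mero_eval f z"
  by (simp_all add: eval_ext_def regular_projection regular_add regular_mult)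

lemma deriv_ext:
  "deriv_ext z (f + g) = deriv_ext z f + deriv_ext z g"
  "deriv_ext z (const c * f) = c * deriv_ext z f"
  "regular_at f z \<Longrightarrow> deriv_ext z f = mero_eval (mero_deriv f) z"
  by (simp_all add: deriv_ext_def regular_projection regular_add regular_mult regular_deriv
      mero_deriv_add mero_deriv_mult)


section \<open>The universal property of the symmetric algebra\<close>

lemma sym_scalar_hom [simp]:
  "sym_scalar 0 = 0" "sym_scalar 1 = 1"
  by (transfer, simp add: sym_rel_def sym_ideal_0)+

lemma sym_scalar_add: "sym_scalar (c + d) = sym_scalar c + sym_scalar d"
  by transfer (simp add: sym_rel_def sym_ideal_0 single_add)

lemma sym_scalar_mult: "sym_scalar (c * d) = sym_scalar c * sym_scalar d"
  by transfer (simp add: sym_rel_def sym_ideal_0 mult_single)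

lemma sym_scalar_uminus: "sym_scalar (- c) = - sym_scalar c"
  using sym_scalar_add[of c "- c"] by (simp add: eq_neg_iff_add_eq_0 add.commute)

lemma sym_scalar_diff: "sym_scalar (c - d) = sym_scalar c - sym_scalar d"
  using sym_scalar_add[of c "- d"] by (simp add: sym_scalar_uminus)

lemma sym_gen_add: "sym_gen (f + g) = sym_gen f + sym_gen g"
  by transfer (use sym_ideal.gen_add in \<open>simp add: sym_rel_def diff_diff_eq\<close>)

lemma sym_gen_scale: "sym_gen (const c * f) = sym_scalar c * sym_gen f"
  by transfer (use sym_ideal.gen_scale in \<open>simp add: sym_rel_def\<close>)

definition free_lift :: "(complex \<Rightarrow> 'a::comm_ring_1) \<Rightarrow> (mero \<Rightarrow> 'a) \<Rightarrow> free_alg \<Rightarrow> 'a" where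
  "free_lift s g a = (\<Sum>m\<in>Poly_Mapping.keys a. s (Poly_Mapping.lookup a m) * (\<Prod>f\<in>#m. g f))"

text \<open>The choice of representative does not matter under the laws of \<open>sym_hom\<close>,
  because \<open>free_lift\<close> then kills \<open>sym_ideal\<close>.\<close>

definition sym_lift :: "(complex \<Rightarrow> 'a::comm_ring_1) \<Rightarrow> (mero \<Rightarrow> 'a) \<Rightarrow> sym_alg \<Rightarrow> 'a" where
  "sym_lift s g a = free_lift s g (rep_sym_alg a)"

text \<open>The target ring is kept general: \<open>sym_alg\<close> itself serves for translations,
  and polynomials over it serve for derivations.\<close>

locale sym_hom =
  fixes s :: "complex \<Rightarrow> 'a::comm_ring_1" and g :: "mero \<Rightarrow> 'a"
  assumes s_1 [simp]: "s 1 = 1"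
    and s_add: "s (c + d) = s c + s d"
    and s_mult: "s (c * d) = s c * s d"
    and g_add: "g (f + h) = g f + g h"
    and g_scale: "g (const c * f) = s c * g f"
begin

lemma s_0 [simp]: "s 0 = 0"
  using s_add[of 0 0] by simp

text \<open>Terms with coefficient 0 contribute \<open>s 0 = 0\<close>. A common index set is needed
  because keys can cancel in a sum.\<close>

lemma free_lift_superset:
  assumes "finite K" "Poly_Mapping.keys a \<subseteq> K"
  shows "free_lift s g a = (\<Sum>m\<in>K. s (Poly_Mapping.lookup a m) * (\<Prod>f\<in>#m. g f))"
  unfolding free_lift_def using assms
  by (intro sum.mono_neutral_left) (auto simp: in_keys_iff)

lemma free_lift_add: "free_lift s g (a + b) = free_lift s g a + free_lift s g b"
proof -
  let ?K = "Poly_Mapping.keys a \<union> Poly_Mapping.keys b"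
  have "Poly_Mapping.keys (a + b) \<subseteq> ?K" by (rule keys_add)
  then show ?thesis
    by (simp add: free_lift_superset[of ?K] lookup_add s_add ring_distribs sum.distrib)
qed

lemma free_lift_single: "free_lift s g (Poly_Mapping.single m c) = s c * (\<Prod>f\<in>#m. g f)"
  by (subst free_lift_superset[of "{m}"]) auto

lemma free_lift_0 [simp]: "free_lift s g 0 = 0"
  by (simp add: free_lift_def)

lemma free_lift_uminus: "free_lift s g (- a) = - free_lift s g a"
  using free_lift_add[of a "- a"] by (simp add: eq_neg_iff_add_eq_0 add.commute)

lemma free_lift_diff: "free_lift s g (a - b) = free_lift s g a - free_lift s g b"
  using free_lift_add[of a "- b"] by (simp add: free_lift_uminus)

lemma free_lift_sum: "free_lift s g (sum h A) = (\<Sum>x\<in>A. free_lift s g (h x))"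
  by (induction A rule: infinite_finite_induct) (simp_all add: free_lift_add)

lemma free_lift_mult: "free_lift s g (a * b) = free_lift s g a * free_lift s g b"
proof -
  \<comment> \<open>Both factors are expanded into monomials, on which multiplicativity is
    immediate.\<close>
  have dec: "a = (\<Sum>m\<in>Poly_Mapping.keys a. Poly_Mapping.single m (Poly_Mapping.lookup a m))" for a :: free_alg
    by (rule poly_mapping_eqI) (simp add: lookup_sum lookup_single when_def in_keys_iff)
  have "free_lift s g (a * b) = (\<Sum>m\<in>Poly_Mapping.keys a. \<Sum>n\<in>Poly_Mapping.keys b.
      free_lift s g (Poly_Mapping.single (m + n) (Poly_Mapping.lookup a m * Poly_Mapping.lookup b n)))"
    by (subst dec[of a], subst dec[of b])
      (simp add: sum_product mult_single free_lift_sum)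
  also have "\<dots> = free_lift s g a * free_lift s g b"
    unfolding free_lift_def[of _ _ a] free_lift_def[of _ _ b] sum_product
    by (simp add: free_lift_single s_mult mult_ac)
  finally show ?thesis .
qed

text \<open>The generators of the ideal are mapped to the defects of additivity and homogeneity of
  \<open>g\<close>, which vanish, and the kernel of a ring homomorphism is an ideal.\<close>

lemma free_lift_ideal: "a \<in> sym_ideal \<Longrightarrow> free_lift s g a = 0"
  by (induction rule: sym_ideal.induct)
    (simp_all add: free_lift_add free_lift_diff free_lift_mult free_lift_single g_add g_scale)

lemma sym_lift_abs: "sym_lift s g (abs_sym_alg a) = free_lift s g a"
proof -
  have "sym_rel (rep_sym_alg (abs_sym_alg a)) a"
    by (rule Quotient3_rep_abs[OF Quotient3_sym_alg]) (simp add: sym_rel_def sym_ideal_0)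
  then have "free_lift s g (rep_sym_alg (abs_sym_alg a) - a) = 0"
    by (intro free_lift_ideal) (simp add: sym_rel_def)
  then show ?thesis by (simp add: sym_lift_def free_lift_diff)
qed

lemma abs_cases: obtains a' where "a = abs_sym_alg a'"
  by (metis Quotient3_abs_rep[OF Quotient3_sym_alg])

lemma sym_lift_add: "sym_lift s g (a + b) = sym_lift s g a + sym_lift s g b"
  by (cases a rule: abs_cases; cases b rule: abs_cases)
    (simp add: plus_sym_alg.abs_eq sym_lift_abs free_lift_add)

lemma sym_lift_mult: "sym_lift s g (a * b) = sym_lift s g a * sym_lift s g b"
  by (cases a rule: abs_cases; cases b rule: abs_cases)
    (simp add: times_sym_alg.abs_eq sym_lift_abs free_lift_mult)

lemma sym_lift_scalar [simp]: "sym_lift s g (sym_scalar c) = s c"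
  by (simp add: sym_scalar.abs_eq sym_lift_abs free_lift_single)

lemma sym_lift_gen [simp]: "sym_lift s g (sym_gen f) = g f"
  by (simp add: sym_gen.abs_eq sym_lift_abs free_lift_single)

end

subsection \<open>Subalgebras\<close>

lemma sym_sub_mono: "M \<subseteq> M' \<Longrightarrow> a \<in> sym_sub M \<Longrightarrow> a \<in> sym_sub M'"
  by (rotate_tac, induction rule: sym_sub.induct) (auto intro: sym_sub.intros)

lemma WW_mono: "Z' \<subseteq> Z \<Longrightarrow> a \<in> WW Z \<Longrightarrow> a \<in> WW Z'"
  unfolding WW_def by (rule sym_sub_mono) (auto simp: mP_def)

lemma WW_scalar [simp]: "sym_scalar c \<in> WW Z"
  by (simp add: WW_def sym_sub.scalar)

lemma WW_0 [simp]: "0 \<in> WW Z" and WW_1 [simp]: "1 \<in> WW Z"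
  using WW_scalar[of 0 Z] WW_scalar[of 1 Z] by simp_all

lemma WW_gen: "f \<in> mP Z \<Longrightarrow> sym_gen f \<in> WW Z"
  by (simp add: WW_def sym_sub.gen)

lemma WW_add: "a \<in> WW Z \<Longrightarrow> b \<in> WW Z \<Longrightarrow> a + b \<in> WW Z"
  by (simp add: WW_def sym_sub.add)

lemma WW_mult: "a \<in> WW Z \<Longrightarrow> b \<in> WW Z \<Longrightarrow> a * b \<in> WW Z"
  by (simp add: WW_def sym_sub.mult)

lemma WW_induct [consumes 1, case_names scalar gen add mult]:
  assumes "a \<in> WW Z"
    and "\<And>c. P (sym_scalar c)"
    and "\<And>f. f \<in> mP Z \<Longrightarrow> P (sym_gen f)"
    and "\<And>a b. a \<in> WW Z \<Longrightarrow> P a \<Longrightarrow> b \<in> WW Z \<Longrightarrow> P b \<Longrightarrow> P (a + b)"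
    and "\<And>a b. a \<in> WW Z \<Longrightarrow> P a \<Longrightarrow> b \<in> WW Z \<Longrightarrow> P b \<Longrightarrow> P (a * b)"
  shows "P a"
  using assms unfolding WW_def by (rule sym_sub.induct)

subsection \<open>Translations and derivations\<close>

text \<open>For \<open>m = \<lambda>\<close> this is the commutator with functions in multiplicative
  form: moving \<open>V\<close> past \<open>\<beta>\<close> replaces \<open>\<beta>\<close> by
  \<open>\<beta> - \<lambda> \<beta>(z)\<close>.\<close>

definition shift_hom :: "complex \<Rightarrow> complex \<Rightarrow> sym_alg \<Rightarrow> sym_alg" where
  "shift_hom m z = sym_lift sym_scalar (\<lambda>f. sym_gen f - sym_scalar (m * eval_ext z f))"

lemma shift_hom_sym_hom: "sym_hom sym_scalar (\<lambda>f. sym_gen f - sym_scalar (m * eval_ext z f))"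
  by standard (simp_all add: sym_scalar_add sym_scalar_mult sym_gen_add sym_gen_scale eval_ext
      right_diff_distrib mult.left_commute distrib_left)

lemmas shift_hom_add = sym_hom.sym_lift_add[OF shift_hom_sym_hom, folded shift_hom_def]
lemmas shift_hom_mult = sym_hom.sym_lift_mult[OF shift_hom_sym_hom, folded shift_hom_def]
lemmas shift_hom_scalar [simp] = sym_hom.sym_lift_scalar[OF shift_hom_sym_hom, folded shift_hom_def]
lemmas shift_hom_gen = sym_hom.sym_lift_gen[OF shift_hom_sym_hom, folded shift_hom_def]

lemma shift_hom_0 [simp]: "shift_hom m z 0 = 0" and shift_hom_1 [simp]: "shift_hom m z 1 = 1"
  using shift_hom_scalar[of m z 0] shift_hom_scalar[of m z 1] by (simp_all del: shift_hom_scalar)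

lemma shift_hom_uminus: "shift_hom m z (- a) = - shift_hom m z a"
  using shift_hom_add[of m z a "- a"] by (simp add: eq_neg_iff_add_eq_0 add.commute)

lemma shift_hom_diff: "shift_hom m z (a - b) = shift_hom m z a - shift_hom m z b"
  using shift_hom_add[of m z a "- b"] by (simp add: shift_hom_uminus)

text \<open>On functions regular at \<open>z\<close> the extended functional is the true value, so
  the arbitrary choice of projection drops out.\<close>

lemma shift_hom_mP:
  "z \<in> Z \<Longrightarrow> f \<in> mP Z \<Longrightarrow> shift_hom m z (sym_gen f) = sym_gen f - sym_scalar (m * mero_eval f z)"
  by (auto simp: shift_hom_gen mP_def eval_ext)

lemma WW_shift_hom:
  assumes "a \<in> WW Z"
  shows "shift_hom m z a \<in> WW Z"
  using assms
proof (induction rule: WW_induct)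
  case (gen f)
  then show ?case
    using WW_add[OF WW_gen[OF gen] WW_scalar[of "- (m * eval_ext z f)"]]
    by (simp add: shift_hom_gen sym_scalar_uminus)
qed (simp_all add: shift_hom_add shift_hom_mult WW_add WW_mult)

text \<open>
  A derivation is the infinitesimal part of a homomorphism to the dual numbers; it is the linear
  coefficient of the homomorphism to polynomials with \<open>f \<mapsto> f - X \<cdot> f'(z)\<close>.
\<close>

definition dual_hom :: "complex \<Rightarrow> sym_alg \<Rightarrow> sym_alg poly" where
  "dual_hom z = sym_lift (\<lambda>c. [:sym_scalar c:]) (\<lambda>f. [:sym_gen f, - sym_scalar (deriv_ext z f):])"

lemma dual_hom_sym_hom:
  "sym_hom (\<lambda>c. [:sym_scalar c:]) (\<lambda>f. [:sym_gen f, - sym_scalar (deriv_ext z f):])"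
  by standard (simp_all add: sym_scalar_add sym_scalar_mult sym_gen_add sym_gen_scale deriv_ext
      one_pCons)

lemmas dual_hom_add = sym_hom.sym_lift_add[OF dual_hom_sym_hom, folded dual_hom_def]
lemmas dual_hom_mult = sym_hom.sym_lift_mult[OF dual_hom_sym_hom, folded dual_hom_def]
lemmas dual_hom_scalar = sym_hom.sym_lift_scalar[OF dual_hom_sym_hom, folded dual_hom_def]
lemmas dual_hom_gen = sym_hom.sym_lift_gen[OF dual_hom_sym_hom, folded dual_hom_def]

definition sym_deriv :: "complex \<Rightarrow> sym_alg \<Rightarrow> sym_alg" where
  "sym_deriv z a = coeff (dual_hom z a) 1"

text \<open>Setting \<open>X = 0\<close> in \<open>dual_hom\<close> gives the homomorphism that
  fixes all scalars and generators.\<close>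

lemma coeff_0_dual_hom: "a \<in> WW Z \<Longrightarrow> coeff (dual_hom z a) 0 = a"
  by (induction rule: WW_induct)
    (simp_all add: dual_hom_add dual_hom_mult dual_hom_scalar dual_hom_gen coeff_mult)

lemma sym_deriv_add: "sym_deriv z (a + b) = sym_deriv z a + sym_deriv z b"
  by (simp add: sym_deriv_def dual_hom_add)

lemma sym_deriv_scalar [simp]: "sym_deriv z (sym_scalar c) = 0"
  by (simp add: sym_deriv_def dual_hom_scalar)

lemma sym_deriv_0 [simp]: "sym_deriv z 0 = 0" and sym_deriv_1 [simp]: "sym_deriv z 1 = 0"
  using sym_deriv_scalar[of z 0] sym_deriv_scalar[of z 1] by (simp_all del: sym_deriv_scalar)

lemma sym_deriv_uminus: "sym_deriv z (- a) = - sym_deriv z a"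
  using sym_deriv_add[of z a "- a"] by (simp add: eq_neg_iff_add_eq_0 add.commute)

lemma sym_deriv_diff: "sym_deriv z (a - b) = sym_deriv z a - sym_deriv z b"
  using sym_deriv_add[of z a "- b"] by (simp add: sym_deriv_uminus)

lemma sym_deriv_gen: "z \<in> Z \<Longrightarrow> f \<in> mP Z \<Longrightarrow> sym_deriv z (sym_gen f) = - sym_scalar (mero_eval (mero_deriv f) z)"
  by (simp add: sym_deriv_def dual_hom_gen deriv_ext mP_def)

text \<open>This is the formula for the linear coefficient of a product of polynomials whose
  constant coefficients are \<open>a\<close> and \<open>b\<close>.\<close>

lemma sym_deriv_mult:
  assumes "a \<in> WW Z" "b \<in> WW Z'"
  shows "sym_deriv z (a * b) = sym_deriv z a * b + a * sym_deriv z b"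
  using assms
  by (simp add: sym_deriv_def dual_hom_mult coeff_mult coeff_0_dual_hom numeral_1_eq_Suc_0 atMost_Suc)

lemma WW_sym_deriv:
  assumes "a \<in> WW Z"
  shows "sym_deriv z a \<in> WW Z"
  using assms
proof (induction rule: WW_induct)
  case (gen f)
  then show ?case
    using WW_scalar[of "- deriv_ext z f" Z] by (simp add: sym_deriv_def dual_hom_gen sym_scalar_uminus)
qed (simp_all add: sym_deriv_add sym_deriv_mult WW_add WW_mult)

text \<open>Either order subtracts the same two scalars from a generator, since scalars are fixed by
  both homomorphisms.\<close>

lemma shift_hom_commute:
  assumes "a \<in> WW Z"
  shows "shift_hom m z (shift_hom m' z' a) = shift_hom m' z' (shift_hom m z a)"
  using assms
  by (induction rule: WW_induct)
    (simp_all add: shift_hom_add shift_hom_mult shift_hom_gen shift_hom_diff)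

text \<open>On a generator, the shift changes the argument by a scalar, which the derivation kills;
  conversely the derivative is a scalar, which the shift fixes.\<close>

lemma sym_deriv_shift_hom:
  assumes "a \<in> WW Z"
  shows "sym_deriv z' (shift_hom m z a) = shift_hom m z (sym_deriv z' a)"
  using assms
proof (induction rule: WW_induct)
  case (gen f)
  then show ?case
    by (simp add: shift_hom_gen sym_deriv_diff)
      (simp add: sym_deriv_def dual_hom_gen shift_hom_uminus)
qed (simp_all add: sym_deriv_add sym_deriv_mult shift_hom_add shift_hom_mult WW_shift_hom
    sym_deriv_mult[OF WW_shift_hom WW_shift_hom])


section \<open>Vectors\<close>

definition orbit :: "mero \<Rightarrow> mero set" where
  "orbit \<sigma> = {const t * \<sigma> | t. t \<noteq> 0}"

lemma orbit_self: "\<sigma> \<in> orbit \<sigma>"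
  by (force simp: orbit_def intro!: exI[of _ 1])

lemma orbit_eq:
  assumes "\<tau> \<in> orbit \<sigma>"
  shows "orbit \<tau> = orbit \<sigma>"
proof -
  obtain t where t: "t \<noteq> 0" "\<tau> = const t * \<sigma>" using assms by (auto simp: orbit_def)
  have "const r * \<tau> \<in> orbit \<sigma>" if "r \<noteq> 0" for r
    using that t by (auto simp: orbit_def const_mult mult_ac intro!: exI[of _ "r * t"])
  moreover have "const r * \<sigma> \<in> orbit \<tau>" if "r \<noteq> 0" for r
    using that t by (auto simp: orbit_def simp flip: const_mult mult.assoc intro!: exI[of _ "r / t"])
  ultimately show ?thesis unfolding orbit_def[of \<tau>] orbit_def[of \<sigma>] by (auto simp: orbit_def)
qed

lemma ord_P_orbit: "\<tau> \<in> orbit \<sigma> \<Longrightarrow> ord_P \<tau> = ord_P \<sigma>"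
  by (cases "\<sigma> = 0") (auto simp: orbit_def)

lemma unit_at_orbit: "unit_at \<sigma> z \<Longrightarrow> \<tau> \<in> orbit \<sigma> \<Longrightarrow> unit_at \<tau> z"
  by (auto simp: orbit_def intro: unit_at_mult unit_at_const)

lemma unit_at_const_mult_iff:
  assumes "t \<noteq> 0"
  shows "unit_at (const t * \<sigma>) z \<longleftrightarrow> unit_at \<sigma> z"
proof
  assume "unit_at (const t * \<sigma>) z"
  then have "unit_at (const (1 / t) * (const t * \<sigma>)) z"
    using assms by (rule_tac unit_at_mult[OF unit_at_const]) auto
  moreover have "const (1 / t) * (const t * \<sigma>) = \<sigma>"
    using assms by (simp flip: const_mult mult.assoc)
  ultimately show "unit_at \<sigma> z" by (simp only:)
qed (simp add: assms unit_at_mult unit_at_const)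

text \<open>Describes the direct sum of all degrees without a decomposition: the degree in the
  homogeneity law is read off as the order of the argument.\<close>

definition equivariant :: "nat \<Rightarrow> complex set \<Rightarrow> wt \<Rightarrow> bool" where
  "equivariant N Z \<rho> \<longleftrightarrow>
     (\<forall>\<sigma>. \<rho> \<sigma> \<noteq> 0 \<longrightarrow> \<sigma> \<noteq> 0 \<and> (\<forall>z\<in>Z. unit_at \<sigma> z)) \<and> (\<forall>\<sigma>. \<rho> \<sigma> \<in> WW Z) \<and>
     (\<forall>t \<sigma>. t \<noteq> 0 \<longrightarrow> \<rho> (const t * \<sigma>) = sym_scalar (t powi (int N * ord_P \<sigma>)) * \<rho> \<sigma>) \<and>
     finite (orbit ` {\<sigma>. \<rho> \<sigma> \<noteq> 0})"

lemma equivariantD: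
  assumes "equivariant N Z \<rho>"
  shows "\<rho> \<sigma> \<noteq> 0 \<Longrightarrow> \<sigma> \<noteq> 0" "\<rho> \<sigma> \<noteq> 0 \<Longrightarrow> z \<in> Z \<Longrightarrow> unit_at \<sigma> z" "\<rho> \<sigma> \<in> WW Z"
    "t \<noteq> 0 \<Longrightarrow> \<rho> (const t * \<sigma>) = sym_scalar (t powi (int N * ord_P \<sigma>)) * \<rho> \<sigma>"
    "finite (orbit ` {\<sigma>. \<rho> \<sigma> \<noteq> 0})"
  using assms unfolding equivariant_def by blast+

lemma Wt_deg_iff:
  "\<rho> \<in> Wt_deg N Z l \<longleftrightarrow> equivariant N Z \<rho> \<and> (\<forall>\<sigma>. \<rho> \<sigma> \<noteq> 0 \<longrightarrow> ord_P \<sigma> = l)"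
proof
  assume \<rho>: "\<rho> \<in> Wt_deg N Z l"
  have supp: "\<sigma> \<in> Ksec Z l" if "\<rho> \<sigma> \<noteq> 0" for \<sigma>
    using \<rho> that unfolding Wt_deg_def by blast
  have hom: "\<rho> (const t * \<sigma>) = sym_scalar (t powi (int N * ord_P \<sigma>)) * \<rho> \<sigma>" if t: "t \<noteq> 0" for t \<sigma>
  proof (cases "\<sigma> \<in> Ksec Z l")
    case True
    then have "\<rho> (const t * \<sigma>) = sym_scalar (t powi (int N * l)) * \<rho> \<sigma>" "ord_P \<sigma> = l"
      using \<rho> t unfolding Wt_deg_def by (blast, simp add: Ksec_iff)
    then show ?thesis by simp
  next
    case False
    then have "const t * \<sigma> \<notin> Ksec Z l"
      using t by (auto simp: Ksec_iff unit_at_const_mult_iff)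
    with False supp have "\<rho> \<sigma> = 0" "\<rho> (const t * \<sigma>) = 0" by blast+
    then show ?thesis by simp
  qed
  have "\<rho> \<sigma> \<in> WW Z" for \<sigma>
    using \<rho> supp[of \<sigma>] unfolding Wt_deg_def by (cases "\<rho> \<sigma> = 0") auto
  moreover have "finite (orbit ` {\<sigma>. \<rho> \<sigma> \<noteq> 0})"
    using \<rho> unfolding Wt_deg_def orbit_def by blast
  ultimately show "equivariant N Z \<rho> \<and> (\<forall>\<sigma>. \<rho> \<sigma> \<noteq> 0 \<longrightarrow> ord_P \<sigma> = l)"
    using supp hom unfolding equivariant_def Ksec_iff by blast
next
  assume \<rho>: "equivariant N Z \<rho> \<and> (\<forall>\<sigma>. \<rho> \<sigma> \<noteq> 0 \<longrightarrow> ord_P \<sigma> = l)"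
  then show "\<rho> \<in> Wt_deg N Z l"
    using equivariantD(5)[of N Z \<rho>]
    unfolding Wt_deg_def orbit_def equivariant_def by (auto simp: Ksec_iff)
qed

lemma sum_fun_apply: "(\<Sum>l\<in>L. r l) x = (\<Sum>l\<in>L. r l x)"
  by (induction L rule: infinite_finite_induct) auto

lemma equivariant_0: "equivariant N Z 0"
  by (simp add: equivariant_def)

lemma equivariant_add:
  assumes "equivariant N Z \<rho>" "equivariant N Z \<tau>"
  shows "equivariant N Z (\<rho> + \<tau>)"
proof -
  have "finite (orbit ` {\<sigma>. (\<rho> + \<tau>) \<sigma> \<noteq> 0})"
    by (rule finite_subset[of _ "orbit ` {\<sigma>. \<rho> \<sigma> \<noteq> 0} \<union> orbit ` {\<sigma>. \<tau> \<sigma> \<noteq> 0}"])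
      (use assms in \<open>auto simp: equivariant_def\<close>)
  moreover have "(\<rho> + \<tau>) \<sigma> \<noteq> 0 \<Longrightarrow> \<rho> \<sigma> \<noteq> 0 \<or> \<tau> \<sigma> \<noteq> 0" for \<sigma> by auto
  ultimately show ?thesis
    using assms unfolding equivariant_def by (auto simp: WW_add distrib_left)
qed

lemma equivariant_sum: "(\<And>l. l \<in> L \<Longrightarrow> equivariant N Z (r l)) \<Longrightarrow> equivariant N Z (\<Sum>l\<in>L. r l)"
  by (induction L rule: infinite_finite_induct) (auto simp: equivariant_0 intro: equivariant_add)

text \<open>Covers operators that act on each value separately. The law \<open>hom\<close> is
  restricted to the support of \<open>\<rho>\<close>, where sections are nonzero and logarithmic
  derivatives are additive.\<close>

lemma equivariant_map:
  assumes \<rho>: "equivariant N Z \<rho>"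
    and 0: "\<And>\<sigma>. F \<sigma> 0 = 0"
    and closed: "\<And>\<sigma> v. v \<in> WW Z \<Longrightarrow> F \<sigma> v \<in> WW Z"
    and hom: "\<And>\<sigma> t b. t \<noteq> 0 \<Longrightarrow> \<rho> \<sigma> \<noteq> 0 \<Longrightarrow>
      F (const t * \<sigma>) (sym_scalar b * \<rho> \<sigma>) = sym_scalar b * F \<sigma> (\<rho> \<sigma>)"
  shows "equivariant N Z (\<lambda>\<sigma>. F \<sigma> (\<rho> \<sigma>))"
proof -
  have "F \<sigma> (\<rho> \<sigma>) \<noteq> 0 \<Longrightarrow> \<rho> \<sigma> \<noteq> 0" for \<sigma> using 0 by auto
  moreover from this have "finite (orbit ` {\<sigma>. F \<sigma> (\<rho> \<sigma>) \<noteq> 0})"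
    by (intro finite_subset[OF _ equivariantD(5)[OF \<rho>]]) auto
  moreover have "F (const t * \<sigma>) (\<rho> (const t * \<sigma>)) = sym_scalar (t powi (int N * ord_P \<sigma>)) * F \<sigma> (\<rho> \<sigma>)"
    if "t \<noteq> 0" for t \<sigma>
    using hom[OF that, of \<sigma>] 0 that by (cases "\<rho> \<sigma> = 0") (auto simp: equivariantD(4)[OF \<rho>])
  ultimately show ?thesis
    using \<rho> closed unfolding equivariant_def by blast
qed

text \<open>A function is cut into its parts of fixed order. Only finitely many orders occur,
  because the order is constant on each of the finitely many orbits in the support.\<close>

lemma Wt_iff: "\<rho> \<in> Wt N Z \<longleftrightarrow> equivariant N Z \<rho>"
proof
  assume "\<rho> \<in> Wt N Z"
  then show "equivariant N Z \<rho>"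
    unfolding Wt_def Wt_deg_iff by (auto intro: equivariant_sum)
next
  assume \<rho>: "equivariant N Z \<rho>"
  define L where "L = ord_P ` {\<sigma>. \<rho> \<sigma> \<noteq> 0}"
  define r where "r = (\<lambda>l \<sigma>. if ord_P \<sigma> = l then \<rho> \<sigma> else 0)"
  \<comment> \<open>A chosen representative turns the order into a function of the orbit, so
    \<open>L\<close> is the image of a finite set.\<close>
  have "ord_P \<sigma> = ord_P (SOME \<tau>. \<tau> \<in> orbit \<sigma>)" for \<sigma>
    using ord_P_orbit[OF someI[of "\<lambda>\<tau>. \<tau> \<in> orbit \<sigma>", OF orbit_self]] by simp
  then have "L = (\<lambda>X. ord_P (SOME \<tau>. \<tau> \<in> X)) ` orbit ` {\<sigma>. \<rho> \<sigma> \<noteq> 0}"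
    unfolding L_def image_image by (intro image_cong) auto
  then have "finite L" using equivariantD(5)[OF \<rho>] by simp
  moreover have "r l \<in> Wt_deg N Z l" for l
    unfolding Wt_deg_iff r_def
    by (intro conjI equivariant_map[OF \<rho>, of "\<lambda>\<sigma> v. if ord_P \<sigma> = l then v else 0"])
      (auto dest: equivariantD(1)[OF \<rho>])
  moreover have "\<rho> = (\<Sum>l\<in>L. r l)"
  proof
    fix \<sigma>
    have "(\<Sum>l\<in>L. r l \<sigma>) = (if ord_P \<sigma> \<in> L then \<rho> \<sigma> else 0)"
      unfolding r_def using \<open>finite L\<close> by (simp add: sum.delta)
    then show "\<rho> \<sigma> = (\<Sum>l\<in>L. r l) \<sigma>"
      by (auto simp: sum_fun_apply L_def)
  qed
  ultimately show "\<rho> \<in> Wt N Z" unfolding Wt_def by blast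
qed

lemma Wt_mono: "Z' \<subseteq> Z \<Longrightarrow> \<rho> \<in> Wt N Z \<Longrightarrow> \<rho> \<in> Wt N Z'"
  unfolding Wt_iff equivariant_def by (blast intro: WW_mono)

lemma Wt_deg_Wt: "\<rho> \<in> Wt_deg N Z l \<Longrightarrow> \<rho> \<in> Wt N Z"
  by (simp add: Wt_iff Wt_deg_iff)

lemma Wt_0: "0 \<in> Wt N Z"
  by (simp add: Wt_iff equivariant_0)

lemma Wt_add: "\<rho> \<in> Wt N Z \<Longrightarrow> \<tau> \<in> Wt N Z \<Longrightarrow> \<rho> + \<tau> \<in> Wt N Z"
  by (simp add: Wt_iff equivariant_add)

lemma Wt_mult:
  assumes "a \<in> WW Z" "\<rho> \<in> Wt N Z"
  shows "(\<lambda>\<sigma>. a * \<rho> \<sigma>) \<in> Wt N Z"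
  using assms unfolding Wt_iff
  by (intro equivariant_map[of N Z \<rho> "\<lambda>_ v. a * v"]) (auto simp: WW_mult mult_ac)

lemma Wt_scale: "\<rho> \<in> Wt N Z \<Longrightarrow> wt_scale c \<rho> \<in> Wt N Z"
  unfolding wt_scale_def by (intro Wt_mult) auto

lemma Wt_act: "f \<in> mP Z \<Longrightarrow> \<rho> \<in> Wt N Z \<Longrightarrow> wt_act f \<rho> \<in> Wt N Z"
  unfolding wt_act_def by (intro Wt_mult WW_gen)

section \<open>Generating vectors and induction over them\<close>

lemma vecE_orbit:
  assumes "\<sigma> \<noteq> 0" "t \<noteq> 0"
  shows "vecE N l v \<sigma> (const t * \<sigma>) = sym_scalar (t powi (int N * l)) * v"
proof -
  have "(THE r. r \<noteq> 0 \<and> const t * \<sigma> = const r * \<sigma>) = t"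
    using assms by (intro the_equality) auto
  then show ?thesis
    using assms unfolding vecE_def by auto
qed

lemma vecE_off_orbit: "\<tau> \<notin> orbit \<sigma> \<Longrightarrow> vecE N l v \<sigma> \<tau> = 0"
  unfolding vecE_def orbit_def by auto

lemma vecE_mult: "vecE N l (a * v) \<sigma> = (\<lambda>\<tau>. a * vecE N l v \<sigma> \<tau>)"
  by (rule ext) (auto simp: vecE_def mult.left_commute)

lemma Wt_vecE:
  assumes \<sigma>: "\<sigma> \<in> Ksec Z l" and v: "v \<in> WW Z"
  shows "vecE N l v \<sigma> \<in> Wt N Z"
proof -
  have "\<sigma> \<noteq> 0" "ord_P \<sigma> = l" and unit: "\<And>z. z \<in> Z \<Longrightarrow> unit_at \<sigma> z" using \<sigma> by (auto simp: Ksec_iff)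
  have supp: "\<tau> \<in> orbit \<sigma>" if "vecE N l v \<sigma> \<tau> \<noteq> 0" for \<tau>
    using that vecE_off_orbit by blast
  have nz: "\<tau> \<noteq> 0" if "\<tau> \<in> orbit \<sigma>" for \<tau>
    using that \<open>\<sigma> \<noteq> 0\<close> by (auto simp: orbit_def)
  have "vecE N l v \<sigma> \<tau> \<in> WW Z" for \<tau>
    unfolding vecE_def using v by (simp add: WW_mult)
  moreover have "vecE N l v \<sigma> (const t * \<tau>) = sym_scalar (t powi (int N * ord_P \<tau>)) * vecE N l v \<sigma> \<tau>"
    if "t \<noteq> 0" for t \<tau>
  proof (cases "\<tau> \<in> orbit \<sigma>")
    case True
    then obtain r where r: "r \<noteq> 0" "\<tau> = const r * \<sigma>" by (auto simp: orbit_def)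
    have "vecE N l v \<sigma> (const t * \<tau>) = sym_scalar ((t * r) powi (int N * l)) * v"
      using vecE_orbit[OF \<open>\<sigma> \<noteq> 0\<close>, of "t * r"] r that by (simp only: const_mult mult.assoc) simp
    moreover have "vecE N l v \<sigma> \<tau> = sym_scalar (r powi (int N * l)) * v"
      unfolding r(2) by (rule vecE_orbit[OF \<open>\<sigma> \<noteq> 0\<close> r(1)])
    ultimately show ?thesis
      using ord_P_orbit[OF True] \<open>ord_P \<sigma> = l\<close>
      by (simp add: power_int_mult_distrib sym_scalar_mult mult.assoc)
  next
    case False
    have "const t * \<tau> \<notin> orbit \<sigma>"
    proof
      assume *: "const t * \<tau> \<in> orbit \<sigma>"
      have "const t * \<tau> \<in> orbit \<tau>" using that by (auto simp: orbit_def)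
      then have "orbit \<tau> = orbit \<sigma>" using orbit_eq * by metis
      with False orbit_self show False by metis
    qed
    with False show ?thesis by (simp add: vecE_off_orbit)
  qed
  moreover have "finite (orbit ` {\<tau>. vecE N l v \<sigma> \<tau> \<noteq> 0})"
    by (rule finite_subset[of _ "{orbit \<sigma>}"]) (use supp orbit_eq in auto)
  ultimately show ?thesis
    unfolding Wt_iff equivariant_def using supp nz unit unit_at_orbit by blast
qed

text \<open>Splitting off the part supported on one orbit, a vector
  \<open>vecE N l v \<sigma>\<close>, lowers the number of orbits in the support. Such a vector
  arises from the vacuum by scaling, multiplication by functions and addition.\<close>

lemma Wt_induct [consumes 1, case_names zero add scale act vac]:
  assumes "\<rho> \<in> Wt N Z"
    and zero: "P 0"
    and add: "\<And>\<rho> \<tau>. \<rho> \<in> Wt N Z \<Longrightarrow> P \<rho> \<Longrightarrow> \<tau> \<in> Wt N Z \<Longrightarrow> P \<tau> \<Longrightarrow> P (\<rho> + \<tau>)"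
    and scale: "\<And>c \<rho>. \<rho> \<in> Wt N Z \<Longrightarrow> P \<rho> \<Longrightarrow> P (wt_scale c \<rho>)"
    and act: "\<And>f \<rho>. f \<in> mP Z \<Longrightarrow> \<rho> \<in> Wt N Z \<Longrightarrow> P \<rho> \<Longrightarrow> P (wt_act f \<rho>)"
    and vac: "\<And>l \<sigma>. \<sigma> \<in> Ksec Z l \<Longrightarrow> P (vecE N l 1 \<sigma>)"
  shows "P \<rho>"
proof -
  \<comment> \<open>The closure properties of \<open>P\<close> extend from scalars and generators to
    multiplication by all of \<open>WW Z\<close>.\<close>
  have mult: "\<forall>\<rho>\<in>Wt N Z. P \<rho> \<longrightarrow> P (\<lambda>\<sigma>. a * \<rho> \<sigma>)" if "a \<in> WW Z" for a
    using that
  proof (induction rule: WW_induct)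
    case (scalar c)
    then show ?case using scale unfolding wt_scale_def by blast
  next
    case (gen f)
    then show ?case using act unfolding wt_act_def by blast
  next
    case (add a b)
    have "(\<lambda>\<sigma>. (a + b) * \<rho> \<sigma>) = (\<lambda>\<sigma>. a * \<rho> \<sigma>) + (\<lambda>\<sigma>. b * \<rho> \<sigma>)" for \<rho> :: wt
      by (auto simp: distrib_right)
    with add show ?case
      using assms(3) Wt_mult by auto
  next
    case (mult a b)
    then show ?case using Wt_mult by (auto simp: mult.assoc)
  qed
  have vec: "P (vecE N l v \<sigma>)" if "\<sigma> \<in> Ksec Z l" "v \<in> WW Z" for l v \<sigma>
    using mult[OF that(2)] vac[OF that(1)] Wt_vecE[OF that(1) WW_1] vecE_mult[of N l v 1 \<sigma>] by auto
  show ?thesis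
    using \<open>\<rho> \<in> Wt N Z\<close>
  proof (induction "card (orbit ` {\<sigma>. \<rho> \<sigma> \<noteq> 0})" arbitrary: \<rho> rule: less_induct)
    case less
    show ?case
    proof (cases "\<rho> = 0")
      case True
      then show ?thesis using zero by simp
    next
      case False
      then obtain \<sigma> where \<sigma>: "\<rho> \<sigma> \<noteq> 0" by (auto simp: fun_eq_iff)
      have \<rho>: "equivariant N Z \<rho>" using less(2) by (simp add: Wt_iff)
      define l where "l = ord_P \<sigma>"
      have K: "\<sigma> \<in> Ksec Z l"
        using equivariantD[OF \<rho>] \<sigma> by (auto simp: Ksec_iff l_def)
      define \<rho>' where "\<rho>' = (\<lambda>\<tau>. if \<tau> \<in> orbit \<sigma> then 0 else \<rho> \<tau>)"
      have split: "\<rho> = vecE N l (\<rho> \<sigma>) \<sigma> + \<rho>'"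
      proof
        fix \<tau>
        show "\<rho> \<tau> = (vecE N l (\<rho> \<sigma>) \<sigma> + \<rho>') \<tau>"
        proof (cases "\<tau> \<in> orbit \<sigma>")
          case True
          then obtain t where "t \<noteq> 0" "\<tau> = const t * \<sigma>" by (auto simp: orbit_def)
          with True show ?thesis
            using K by (simp add: \<rho>'_def vecE_orbit Ksec_iff equivariantD(4)[OF \<rho>])
        qed (simp add: \<rho>'_def vecE_off_orbit)
      qed
      have E: "vecE N l (\<rho> \<sigma>) \<sigma> \<in> Wt N Z"
        using K equivariantD(3)[OF \<rho>] by (rule Wt_vecE)
      \<comment> \<open>Written as a linear combination, the remainder inherits membership in
        \<open>Wt N Z\<close>.\<close>
      have "\<rho>' = \<rho> + wt_scale (-1) (vecE N l (\<rho> \<sigma>) \<sigma>)"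
        by (subst split) (simp add: wt_scale_def fun_eq_iff sym_scalar_uminus)
      then have W: "\<rho>' \<in> Wt N Z"
        using less(2) E by (simp add: Wt_add Wt_scale)
      have "orbit \<sigma> \<notin> orbit ` {\<tau>. \<rho>' \<tau> \<noteq> 0}"
        using orbit_self by (auto simp: \<rho>'_def split: if_splits)
      moreover have "orbit \<sigma> \<in> orbit ` {\<tau>. \<rho> \<tau> \<noteq> 0}" using \<sigma> by auto
      moreover have "orbit ` {\<tau>. \<rho>' \<tau> \<noteq> 0} \<subseteq> orbit ` {\<tau>. \<rho> \<tau> \<noteq> 0}"
        by (auto simp: \<rho>'_def)
      ultimately have "card (orbit ` {\<tau>. \<rho>' \<tau> \<noteq> 0}) < card (orbit ` {\<tau>. \<rho> \<tau> \<noteq> 0})"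
        by (intro psubset_card_mono equivariantD(5)[OF \<rho>]) blast
      from less(1)[OF this W] have "P \<rho>'" .
      then have "P (vecE N l (\<rho> \<sigma>) \<sigma> + \<rho>')"
        using add E W vec[OF K equivariantD(3)[OF \<rho>]] by blast
      then show ?thesis using split by simp
    qed
  qed
qed


section \<open>The fields in closed form\<close>

lemma linear_on_wt_0:
  assumes "linear_on_wt (Wt N Z) A"
  shows "A 0 = 0"
proof -
  have "wt_scale 0 \<rho> = 0" for \<rho> by (auto simp: wt_scale_def)
  moreover have "A (wt_scale 0 0) = wt_scale 0 (A 0)"
    using assms Wt_0[of N Z] unfolding linear_on_wt_def by blast
  ultimately show ?thesis by metis
qed

text \<open>Yields uniqueness of the fields: operators with the same commutation rule satisfy
  \<open>act\<close>, and \<open>vac\<close> is the prescription on vacuum vectors.\<close>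

lemma linear_on_wt_eqI:
  assumes A: "linear_on_wt (Wt N Z) A" and B: "linear_on_wt (Wt N Z) B"
    and act: "\<And>f \<rho>. f \<in> mP Z \<Longrightarrow> \<rho> \<in> Wt N Z \<Longrightarrow> A \<rho> = B \<rho> \<Longrightarrow> A (wt_act f \<rho>) = B (wt_act f \<rho>)"
    and vac: "\<And>l \<sigma>. \<sigma> \<in> Ksec Z l \<Longrightarrow> A (vecE N l 1 \<sigma>) = B (vecE N l 1 \<sigma>)"
    and \<rho>: "\<rho> \<in> Wt N Z"
  shows "A \<rho> = B \<rho>"
  using \<rho>
proof (induction rule: Wt_induct)
  case zero
  then show ?case using linear_on_wt_0[OF A] linear_on_wt_0[OF B] by metis
next
  case (add \<rho> \<tau>)
  then show ?case using A B unfolding linear_on_wt_def by metis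
next
  case (scale c \<rho>)
  then show ?case using A B unfolding linear_on_wt_def by metis
qed (simp_all add: act vac)

section \<open>Closed form of \<open>\<iota>(z)\<close>\<close>

definition iota_op :: "nat \<Rightarrow> complex \<Rightarrow> wt \<Rightarrow> wt" where
  "iota_op N z \<rho> = (\<lambda>\<sigma>. sym_deriv z (\<rho> \<sigma>) -
     sym_scalar (of_real (sqrt (real N)) * mero_eval (log_nabla \<sigma>) z) * \<rho> \<sigma>)"

lemma sym_deriv_scalar_mult:
  "v \<in> WW Z \<Longrightarrow> sym_deriv z (sym_scalar b * v) = sym_scalar b * sym_deriv z v"
  using sym_deriv_mult[of "sym_scalar b" Z v Z z] by simp

text \<open>Homogeneity survives because the logarithmic derivative of a section is unchanged by
  nonzero constant factors. The set \<open>Z\<close> and the point \<open>z\<close> are independent,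
  as \<open>\<iota>(z')\<close> has to preserve regularity at \<open>z\<close>.\<close>

lemma Wt_iota_op:
  assumes "\<rho> \<in> Wt N Z"
  shows "iota_op N z \<rho> \<in> Wt N Z"
proof -
  have \<rho>: "equivariant N Z \<rho>" using assms by (simp add: Wt_iff)
  have minus: "v - sym_scalar b * w \<in> WW Z" if "v \<in> WW Z" "w \<in> WW Z" for v w b
    using WW_add[OF that(1) WW_mult[OF WW_scalar[of "-b"] that(2)]] by (simp add: sym_scalar_uminus)
  show ?thesis
    unfolding iota_op_def Wt_iff
    by (rule equivariant_map[OF \<rho>])
      (use equivariantD(1)[OF \<rho>] in \<open>auto simp: minus WW_sym_deriv sym_deriv_scalar_mult[OF equivariantD(3)[OF \<rho>]]
        log_nabla_mult right_diff_distrib mult.left_commute\<close>)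
qed

text \<open>The closed form meets the defining conditions, and these determine an operator by
  induction over vectors; both are needed to evaluate the definite description.\<close>

lemma iota_field_eq:
  assumes "\<rho> \<in> Wt N {z}"
  shows "iota_field N z \<rho> = iota_op N z \<rho>"
proof -
  \<comment> \<open>Restriction sets the operator to \<open>undefined\<close> off the domain, as the
    extensional function space demands.\<close>
  let ?A = "restrict (iota_op N z) (Wt N {z})"
  let ?spec = "\<lambda>A. A \<in> Wt N {z} \<rightarrow>\<^sub>E Wt N {} \<and> linear_on_wt (Wt N {z}) A \<and>
     (\<forall>\<beta>\<in>mP {z}. \<forall>\<rho>\<in>Wt N {z}.
        A (wt_act \<beta> \<rho>) - wt_act \<beta> (A \<rho>) = wt_scale (- mero_eval (mero_deriv \<beta>) z) \<rho>) \<and>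
     (\<forall>l. \<forall>\<sigma>\<in>Ksec {z} l.
        A (vecE N l 1 \<sigma>) =
          wt_scale (- (of_real (sqrt (real N)) * mero_eval (log_nabla \<sigma>) z)) (vecE N l 1 \<sigma>))"
  have "?spec ?A"
  proof (intro conjI ballI allI)
    show "?A \<in> Wt N {z} \<rightarrow>\<^sub>E Wt N {}"
      using Wt_iota_op Wt_mono[of "{}" "{z}"] by (auto simp: restrict_PiE_iff)
    have WW: "\<rho> \<sigma> \<in> WW {z}" if "\<rho> \<in> Wt N {z}" for \<rho> \<sigma>
      using that by (simp add: Wt_iff equivariantD)
    show "linear_on_wt (Wt N {z}) ?A"
      using sym_deriv_scalar_mult[OF WW]
      by (auto simp: linear_on_wt_def Wt_add Wt_scale)
        (auto simp: iota_op_def wt_scale_def sym_deriv_add algebra_simps)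
    show "?A (wt_act \<beta> \<rho>) - wt_act \<beta> (?A \<rho>) = wt_scale (- mero_eval (mero_deriv \<beta>) z) \<rho>"
      if "\<beta> \<in> mP {z}" "\<rho> \<in> Wt N {z}" for \<beta> \<rho>
    proof
      fix \<sigma>
      show "(?A (wt_act \<beta> \<rho>) - wt_act \<beta> (?A \<rho>)) \<sigma> = wt_scale (- mero_eval (mero_deriv \<beta>) z) \<rho> \<sigma>"
        using that Wt_act[OF that] sym_deriv_mult[OF WW_gen[OF that(1)] WW[OF that(2)], of z \<sigma>]
        by (simp add: iota_op_def wt_act_def wt_scale_def sym_deriv_gen[of z "{z}"] sym_scalar_uminus
            algebra_simps)
    qed
    show "?A (vecE N l 1 \<sigma>) =
        wt_scale (- (of_real (sqrt (real N)) * mero_eval (log_nabla \<sigma>) z)) (vecE N l 1 \<sigma>)"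
      if "\<sigma> \<in> Ksec {z} l" for l \<sigma>
    proof
      fix \<tau>
      have nz: "\<sigma> \<noteq> 0" using that by (simp add: Ksec_iff)
      show "?A (vecE N l 1 \<sigma>) \<tau> =
        wt_scale (- (of_real (sqrt (real N)) * mero_eval (log_nabla \<sigma>) z)) (vecE N l 1 \<sigma>) \<tau>"
      proof (cases "\<tau> \<in> orbit \<sigma>")
        case True
        then show ?thesis
          using nz Wt_vecE[OF that WW_1]
          by (auto simp: orbit_def iota_op_def wt_scale_def vecE_orbit log_nabla_mult sym_scalar_uminus)
      next
        case False
        then show ?thesis
          using Wt_vecE[OF that WW_1] by (simp add: iota_op_def wt_scale_def vecE_off_orbit)
      qed
    qed
  qed
  moreover have "A = ?A" if "?spec A" for A
  proof (rule PiE_ext)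
    show "A \<in> Wt N {z} \<rightarrow>\<^sub>E Wt N {}" "?A \<in> Wt N {z} \<rightarrow>\<^sub>E Wt N {}"
      using that \<open>?spec ?A\<close> by blast+
    show "A \<rho> = ?A \<rho>" if "\<rho> \<in> Wt N {z}" for \<rho>
    proof (rule linear_on_wt_eqI[OF _ _ _ _ that])
      \<comment> \<open>The commutator expresses \<open>A (wt_act f \<rho>)\<close> through
        \<open>A \<rho>\<close> and \<open>\<rho>\<close>.\<close>
      show "A (wt_act f \<rho>) = ?A (wt_act f \<rho>)"
        if "f \<in> mP {z}" "\<rho> \<in> Wt N {z}" "A \<rho> = ?A \<rho>" for f \<rho>
        using \<open>?spec A\<close> \<open>?spec ?A\<close> that by (metis (no_types, lifting) diff_eq_eq)
      show "linear_on_wt (Wt N {z}) A" "linear_on_wt (Wt N {z}) ?A"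
        using \<open>?spec A\<close> \<open>?spec ?A\<close> by blast+
      show "A (vecE N l 1 \<sigma>) = ?A (vecE N l 1 \<sigma>)" if "\<sigma> \<in> Ksec {z} l" for l \<sigma>
        using \<open>?spec A\<close> \<open>?spec ?A\<close> that by metis
    qed
  qed
  ultimately have "iota_field N z = ?A"
    unfolding iota_field_def by (rule the_equality)
  then show ?thesis using assms by simp
qed

section \<open>Closed form of the vertex operators\<close>

context coord
begin

definition V_coeff :: "nat \<Rightarrow> int \<Rightarrow> complex \<Rightarrow> mero \<Rightarrow> complex" where
  "V_coeff N c z \<sigma> = mero_eval \<sigma> z powi (int N * c) * du_at u z powi (- (int N * c * (ord_P \<sigma> + c)))"

text \<open>
  The value at \<open>\<tau>\<close> is determined by the only \<open>\<sigma>\<close> whose shift \<open>(u - u(z))\<^sup>-\<^sup>c \<sigma>\<close> is \<open>\<tau>\<close>.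
\<close>

definition V_op :: "nat \<Rightarrow> int \<Rightarrow> complex \<Rightarrow> wt \<Rightarrow> wt" where
  "V_op N c z \<rho> = (\<lambda>\<tau>. sym_scalar (V_coeff N c z (w z powi c * \<tau>)) *
     shift_hom (of_real (sqrt (real N) * of_int c)) z (\<rho> (w z powi c * \<tau>)))"

lemma w_powi_cancel [simp]:
  "w z powi c * (w z powi (- c) * \<tau>) = \<tau>" "w z powi (- c) * (w z powi c * \<tau>) = \<tau>"
  using w_simps(3)[of z] by (simp_all add: power_int_minus)

lemma w_powi_nonzero: "w z powi c \<noteq> 0"
  using w_simps(3)[of z] by simp

lemma ord_P_w_powi: "\<tau> \<noteq> 0 \<Longrightarrow> ord_P (w z powi c * \<tau>) = ord_P \<tau> - c"
  using w_simps(3,4)[of z] by (simp add: ord_P_mult ord_P_powi w_powi_nonzero)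

text \<open>The factor \<open>t powi (int N * c)\<close> is what raises homogeneity from degree
  \<open>l\<close> to degree \<open>l + c\<close>.\<close>

lemma V_coeff_const_mult:
  assumes "t \<noteq> 0" "unit_at \<sigma> z"
  shows "V_coeff N c z (const t * \<sigma>) = t powi (int N * c) * V_coeff N c z \<sigma>"
  using assms unit_at_nonzero[OF assms(2)]
  by (simp add: V_coeff_def unit_at_def regular_mult power_int_mult_distrib)

text \<open>Regularity is lost only at \<open>z\<close>, since \<open>w z\<close> is a unit at every
  other point. A general \<open>Z\<close> is carried along so that a field at another point of
  \<open>Z\<close> can be applied afterwards.\<close>

lemma Wt_V_op:
  assumes "\<rho> \<in> Wt N Z" "z \<in> Z"
  shows "V_op N c z \<rho> \<in> Wt N (Z - {z})"
proof -
  have \<rho>: "equivariant N Z \<rho>" using assms by (simp add: Wt_iff)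
  have supp: "\<rho> (w z powi c * \<tau>) \<noteq> 0" if "V_op N c z \<rho> \<tau> \<noteq> 0" for \<tau>
    using that by (auto simp: V_op_def)
  have "\<tau> \<noteq> 0 \<and> (\<forall>z'\<in>Z - {z}. unit_at \<tau> z')" if "V_op N c z \<rho> \<tau> \<noteq> 0" for \<tau>
  proof -
    have nz: "w z powi c * \<tau> \<noteq> 0" using equivariantD(1)[OF \<rho>] supp[OF that] by blast
    have "unit_at (w z powi (- c) * (w z powi c * \<tau>)) z'" if "z' \<in> Z - {z}" for z'
      using that equivariantD(2)[OF \<rho> supp[OF \<open>V_op N c z \<rho> \<tau> \<noteq> 0\<close>], of z']
      by (rule_tac unit_at_mult[OF unit_at_powi(1)[OF unit_at_w]]) auto
    with nz show ?thesis by auto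
  qed
  moreover have "V_op N c z \<rho> \<tau> \<in> WW (Z - {z})" for \<tau>
    unfolding V_op_def
    by (intro WW_mult WW_scalar WW_shift_hom WW_mono[OF _ equivariantD(3)[OF \<rho>]]) auto
  moreover have "V_op N c z \<rho> (const t * \<tau>) = sym_scalar (t powi (int N * ord_P \<tau>)) * V_op N c z \<rho> \<tau>"
    if t: "t \<noteq> 0" for t \<tau>
  proof -
    let ?\<sigma> = "w z powi c * \<tau>"
    have e: "w z powi c * (const t * \<tau>) = const t * ?\<sigma>" by (simp add: mult_ac)
    show ?thesis
    proof (cases "\<rho> ?\<sigma> = 0")
      case True
      then show ?thesis unfolding V_op_def e equivariantD(4)[OF \<rho> t] by simp
    next
      case False
      then have \<sigma>: "unit_at ?\<sigma> z" "?\<sigma> \<noteq> 0"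
        using equivariantD(1,2)[OF \<rho>] \<open>z \<in> Z\<close> by blast+
      then have \<tau>: "\<tau> \<noteq> 0" by auto
      have "t powi (int N * ord_P \<tau>) = t powi (int N * c) * t powi (int N * ord_P ?\<sigma>)"
        unfolding ord_P_w_powi[OF \<tau>] using t by (simp add: algebra_simps flip: power_int_add)
      then have "sym_scalar (t powi (int N * ord_P \<tau>)) =
          sym_scalar (t powi (int N * c)) * sym_scalar (t powi (int N * ord_P ?\<sigma>))"
        by (simp only: sym_scalar_mult)
      then show ?thesis
        unfolding V_op_def e equivariantD(4)[OF \<rho> t] V_coeff_const_mult[OF t \<sigma>(1)]
          shift_hom_mult shift_hom_scalar sym_scalar_mult
        by (simp only: mult_ac)
    qed
  qed
  moreover have "finite (orbit ` {\<tau>. V_op N c z \<rho> \<tau> \<noteq> 0})"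
  proof (rule finite_subset)
    show "finite ((\<lambda>X. (*) (w z powi (- c)) ` X) ` orbit ` {\<sigma>. \<rho> \<sigma> \<noteq> 0})"
      using equivariantD(5)[OF \<rho>] by simp
    \<comment> \<open>Multiplication by a power of \<open>w z\<close> maps orbits onto orbits, so
      the support still meets finitely many.\<close>
    have "orbit \<tau> = (*) (w z powi (- c)) ` orbit (w z powi c * \<tau>)" for \<tau>
    proof -
      have "w z powi (- c) * (const t * (w z powi c * \<tau>)) = const t * \<tau>" for t
        by (simp add: mult.left_commute[of _ "const t"])
      then show ?thesis
        unfolding orbit_def setcompr_eq_image image_image by (simp only:)
    qed
    then show "orbit ` {\<tau>. V_op N c z \<rho> \<tau> \<noteq> 0} \<subseteq>
        (\<lambda>X. (*) (w z powi (- c)) ` X) ` orbit ` {\<sigma>. \<rho> \<sigma> \<noteq> 0}"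
      using supp by blast
  qed
  ultimately show ?thesis
    unfolding Wt_iff equivariant_def by blast
qed

lemma Wt_V_op': "\<rho> \<in> Wt N {z} \<Longrightarrow> V_op N c z \<rho> \<in> Wt N {}"
  using Wt_V_op[of \<rho> N "{z}" z] by simp

lemma Wt_deg_V_op:
  assumes "\<rho> \<in> Wt_deg N {z} l"
  shows "V_op N c z \<rho> \<in> Wt_deg N {} (l + c)"
proof -
  have "ord_P \<tau> = l + c" if "V_op N c z \<rho> \<tau> \<noteq> 0" for \<tau>
  proof -
    have "\<rho> (w z powi c * \<tau>) \<noteq> 0" using that by (auto simp: V_op_def)
    then have "ord_P (w z powi c * \<tau>) = l" "w z powi c * \<tau> \<noteq> 0"
      using assms equivariantD(1) unfolding Wt_deg_iff by blast+
    then show ?thesis using ord_P_w_powi[of \<tau> z c] by auto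
  qed
  then show ?thesis
    using Wt_V_op'[OF Wt_deg_Wt[OF assms]] unfolding Wt_deg_iff Wt_iff by blast
qed

lemma V_op_vecE:
  assumes "\<sigma> \<in> Ksec {z} l"
  shows "V_op N c z (vecE N l 1 \<sigma>) =
    wt_scale (mero_eval \<sigma> z powi (int N * c) * du_at u z powi (- (int N * c * (l + c))))
      (vecE N (l + c) 1 (w z powi (- c) * \<sigma>))"
proof
  fix \<tau>
  have \<sigma>: "\<sigma> \<noteq> 0" "ord_P \<sigma> = l" "unit_at \<sigma> z" using assms by (auto simp: Ksec_iff)
  have nz: "w z powi (- c) * \<sigma> \<noteq> 0" using w_powi_nonzero[of z "- c"] \<sigma> by simp
  show "V_op N c z (vecE N l 1 \<sigma>) \<tau> =
    wt_scale (mero_eval \<sigma> z powi (int N * c) * du_at u z powi (- (int N * c * (l + c))))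
      (vecE N (l + c) 1 (w z powi (- c) * \<sigma>)) \<tau>"
  proof (cases "\<tau> \<in> orbit (w z powi (- c) * \<sigma>)")
    case True
    then obtain t where t: "t \<noteq> 0" "\<tau> = const t * (w z powi (- c) * \<sigma>)" by (auto simp: orbit_def)
    then have e: "w z powi c * \<tau> = const t * \<sigma>"
      by (simp add: mult.left_commute[of _ "const t"])
    have p: "t powi (int N * (l + c)) = t powi (int N * c) * t powi (int N * l)"
      using t(1) by (simp add: algebra_simps flip: power_int_add)
    show ?thesis
      unfolding V_op_def e V_coeff_const_mult[OF t(1) \<sigma>(3)] vecE_orbit[OF \<sigma>(1) t(1)]
      unfolding t(2) wt_scale_def vecE_orbit[OF nz t(1)]
      by (simp add: V_coeff_def \<sigma>(2) p mult_ac flip: sym_scalar_mult)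
  next
    case False
    have "w z powi c * \<tau> \<notin> orbit \<sigma>"
    proof
      assume "w z powi c * \<tau> \<in> orbit \<sigma>"
      then obtain t where t: "t \<noteq> 0" "w z powi c * \<tau> = const t * \<sigma>" by (auto simp: orbit_def)
      then have "\<tau> = const t * (w z powi (- c) * \<sigma>)"
        using w_powi_cancel(2)[of z c \<tau>] by (simp add: mult.left_commute[of _ "const t"])
      with t False show False by (auto simp: orbit_def)
    qed
    with False show ?thesis by (simp add: V_op_def wt_scale_def vecE_off_orbit)
  qed
qed

text \<open>Existence is given by \<open>V_op\<close>. Uniqueness again follows by induction over
  vectors, the commutator giving \<open>A (wt_act \<beta> \<rho>)\<close> in terms of
  \<open>A \<rho>\<close>.\<close>

lemma V_field_eq:
  assumes "\<rho> \<in> Wt N {z}"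
  shows "V_field N u c z \<rho> = V_op N c z \<rho>"
proof -
  let ?A = "restrict (V_op N c z) (Wt N {z})"
  let ?spec = "\<lambda>A. A \<in> Wt N {z} \<rightarrow>\<^sub>E Wt N {} \<and> linear_on_wt (Wt N {z}) A \<and>
     (\<forall>l. \<forall>\<rho>\<in>Wt_deg N {z} l. A \<rho> \<in> Wt_deg N {} (l + c)) \<and>
     (\<forall>\<beta>\<in>mP {z}. \<forall>\<rho>\<in>Wt N {z}.
        A (wt_act \<beta> \<rho>) - wt_act \<beta> (A \<rho>) =
          wt_scale (- (of_real (sqrt (real N) * of_int c) * mero_eval \<beta> z)) (A \<rho>)) \<and>
     (\<forall>l. \<forall>\<sigma>\<in>Ksec {z} l.
        A (vecE N l 1 \<sigma>) =
          wt_scale (mero_eval \<sigma> z powi (int N * c) * du_at u z powi (- (int N * c * (l + c))))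
            (vecE N (l + c) 1 (w z powi (- c) * \<sigma>)))"
  have "?spec ?A"
  proof (intro conjI ballI allI)
    show "?A \<in> Wt N {z} \<rightarrow>\<^sub>E Wt N {}"
      using Wt_V_op' by (auto simp: restrict_PiE_iff)
    show "linear_on_wt (Wt N {z}) ?A"
      by (auto simp: linear_on_wt_def Wt_add Wt_scale)
        (auto simp: V_op_def wt_scale_def shift_hom_add shift_hom_mult algebra_simps)
    show "?A \<rho> \<in> Wt_deg N {} (l + c)" if "\<rho> \<in> Wt_deg N {z} l" for \<rho> l
      using Wt_deg_V_op[OF that] Wt_deg_Wt[OF that] by simp
    show "?A (wt_act \<beta> \<rho>) - wt_act \<beta> (?A \<rho>) =
          wt_scale (- (of_real (sqrt (real N) * of_int c) * mero_eval \<beta> z)) (?A \<rho>)"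
      if "\<beta> \<in> mP {z}" "\<rho> \<in> Wt N {z}" for \<beta> \<rho>
      using that Wt_act[OF that]
      by (auto simp: V_op_def wt_act_def wt_scale_def shift_hom_mult shift_hom_mP[of z "{z}"]
          sym_scalar_uminus algebra_simps)
    show "?A (vecE N l 1 \<sigma>) =
          wt_scale (mero_eval \<sigma> z powi (int N * c) * du_at u z powi (- (int N * c * (l + c))))
            (vecE N (l + c) 1 (w z powi (- c) * \<sigma>))"
      if "\<sigma> \<in> Ksec {z} l" for l \<sigma>
      using V_op_vecE[OF that] Wt_vecE[OF that WW_1] by simp
  qed
  moreover have "A = ?A" if "?spec A" for A
  proof (rule PiE_ext)
    show "A \<in> Wt N {z} \<rightarrow>\<^sub>E Wt N {}" "?A \<in> Wt N {z} \<rightarrow>\<^sub>E Wt N {}"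
      using that \<open>?spec ?A\<close> by blast+
    show "A \<rho> = ?A \<rho>" if "\<rho> \<in> Wt N {z}" for \<rho>
    proof (rule linear_on_wt_eqI[OF _ _ _ _ that])
      show "A (wt_act f \<rho>) = ?A (wt_act f \<rho>)"
        if "f \<in> mP {z}" "\<rho> \<in> Wt N {z}" "A \<rho> = ?A \<rho>" for f \<rho>
        using \<open>?spec A\<close> \<open>?spec ?A\<close> that by (metis (no_types, lifting) diff_eq_eq)
      show "linear_on_wt (Wt N {z}) A" "linear_on_wt (Wt N {z}) ?A"
        using \<open>?spec A\<close> \<open>?spec ?A\<close> by blast+
      show "A (vecE N l 1 \<sigma>) = ?A (vecE N l 1 \<sigma>)" if "\<sigma> \<in> Ksec {z} l" for l \<sigma>
        using \<open>?spec A\<close> \<open>?spec ?A\<close> that by metis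
    qed
  qed
  ultimately have "V_field N u c z = ?A"
    unfolding V_field_def by (rule the_equality)
  then show ?thesis using assms by simp
qed

section \<open>Commutation relations\<close>

lemma Wt_eps_field:
  assumes "z \<notin> Z" "\<rho> \<in> Wt N Z"
  shows "eps_field u z \<rho> \<in> Wt N Z"
  unfolding eps_field_def using assms inverse_w_mP by (intro Wt_scale Wt_act)

text \<open>Both sides at \<open>\<tau>\<close> involve \<open>\<rho>\<close> only at
  \<open>\<sigma> = w z powi c * \<tau>\<close>. The derivation commutes with the shift, so what
  remains is an identity of scalars multiplying \<open>K * ?\<phi> v\<close>.\<close>

lemma j_field_V_field_commute:
  assumes "z \<noteq> z'" and \<rho>: "\<rho> \<in> Wt N {z, z'}"
  shows "j_field N u z' (V_field N u c z \<rho>) = V_field N u c z (j_field N u z' \<rho>)"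
proof -
  have \<rho>z: "\<rho> \<in> Wt N {z}" "\<rho> \<in> Wt N {z'}"
    using Wt_mono[OF _ \<rho>, of "{z}"] Wt_mono[OF _ \<rho>, of "{z'}"] by auto
  have eq: "equivariant N {z, z'} \<rho>" using \<rho> by (simp add: Wt_iff)
  have "{z, z'} - {z} = {z'}" using assms(1) by auto
  then have V: "V_op N c z \<rho> \<in> Wt N {z'}"
    using Wt_V_op[OF \<rho>, of z c] by simp
  have j: "eps_field u z' \<rho> + iota_op N z' \<rho> \<in> Wt N {z}"
    using assms \<rho>z by (intro Wt_add Wt_eps_field Wt_iota_op) auto
  have "eps_field u z' (V_op N c z \<rho>) \<tau> + iota_op N z' (V_op N c z \<rho>) \<tau> =
      V_op N c z (eps_field u z' \<rho> + iota_op N z' \<rho>) \<tau>" for \<tau>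
  proof -
    define \<sigma> where "\<sigma> = w z powi c * \<tau>"
    define v where "v = \<rho> \<sigma>"
    define m :: complex where "m = of_real (sqrt (real N) * of_int c)"
    define K where "K = sym_scalar (V_coeff N c z \<sigma>)"
    have v: "v \<in> WW {z, z'}" unfolding v_def by (rule equivariantD(3)[OF eq])
    let ?\<phi> = "shift_hom m z"
    let ?g = "1 / w z'"
    have g: "?\<phi> (sym_gen ?g) = sym_gen ?g - sym_scalar (m * mero_eval ?g z)"
      using assms inverse_w_mP[of z' "{z}"] by (intro shift_hom_mP[of z "{z}"]) auto
    show ?thesis
    \<comment> \<open>For \<open>v = 0\<close> nothing is known about \<open>\<sigma>\<close>, but
      both sides vanish; otherwise \<open>\<sigma>\<close> is regular and nonvanishing at
      \<open>z'\<close>.\<close>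
    proof (cases "v = 0")
      case True
      then show ?thesis
        by (simp add: V_op_def eps_field_def iota_op_def wt_scale_def wt_act_def flip: \<sigma>_def v_def)
    next
      case False
      then have \<sigma>: "\<sigma> \<noteq> 0" "unit_at \<sigma> z'"
        using equivariantD(1,2)[OF eq] by (auto simp: v_def)
      have \<tau>: "\<tau> = w z powi (- c) * \<sigma>" by (simp add: \<sigma>_def)
      have "log_nabla \<tau> = const (of_int (- c)) * log_nabla (w z) + log_nabla \<sigma>"
        unfolding \<tau> using \<sigma>(1) w_simps(3)[of z] w_powi_nonzero[of z "- c"]
        by (simp only: log_nabla_mult log_nabla_powi of_int_const[symmetric] not_False_eq_True)
      moreover have "regular_at (const (of_int (- c)) * log_nabla (w z)) z'"
        "mero_eval (const (of_int (- c)) * log_nabla (w z)) z' = of_int (- c) * (1 / (z' - z))"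
        using log_nabla_regular[OF unit_at_w[OF assms(1)]] w_simps(6)[of z]
          regular_mult[of "const (of_int (- c))" z' "log_nabla (w z)"]
        by (simp_all add: w_simps(2,5))
      \<comment> \<open>Passing from \<open>\<sigma>\<close> to \<open>\<tau>\<close> adds
        \<open>- c\<close> times the logarithmic derivative of \<open>w z\<close> at
        \<open>z'\<close>, which is \<open>1 / (z' - z)\<close>.\<close>
      ultimately have ln: "mero_eval (log_nabla \<tau>) z' = of_int (- c) * (1 / (z' - z)) + mero_eval (log_nabla \<sigma>) z'"
        using log_nabla_regular(1)[OF \<sigma>(2)] by (simp only: regular_add)
      have ev: "mero_eval ?g z = 1 / (du_at u z' * (z - z'))"
        using unit_at_inverse(2)[OF unit_at_w[of z' z]] assms(1)
        by (simp add: divide_inverse w_simps(2))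
      \<comment> \<open>The two contributions cancel because \<open>z - z'\<close> and
        \<open>z' - z\<close> are opposite and the factor \<open>du_at u z'\<close> removes the
        scale of the coordinate.\<close>
      have "- (of_real (sqrt (real N)) * mero_eval (log_nabla \<tau>) z') =
          - (du_at u z' * (m * mero_eval ?g z)) - of_real (sqrt (real N)) * mero_eval (log_nabla \<sigma>) z'"
        unfolding ln ev m_def using w_simps(6)[of z'] assms(1) by (simp add: field_simps)
      from arg_cong[OF this, of "\<lambda>c. sym_scalar c * (K * ?\<phi> v)"]
      have scal: "- (sym_scalar (of_real (sqrt (real N)) * mero_eval (log_nabla \<tau>) z') * (K * ?\<phi> v)) =
          - (sym_scalar (du_at u z') * sym_scalar (m * mero_eval ?g z) * (K * ?\<phi> v))
          - sym_scalar (of_real (sqrt (real N)) * mero_eval (log_nabla \<sigma>) z') * (K * ?\<phi> v)"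
        by (simp only: sym_scalar_diff sym_scalar_uminus sym_scalar_mult[of "du_at u z'"] left_diff_distrib
            mult_minus_left)
      have D: "sym_deriv z' (K * ?\<phi> v) = K * ?\<phi> (sym_deriv z' v)"
        unfolding K_def sym_deriv_scalar_mult[OF WW_shift_hom[OF v]] sym_deriv_shift_hom[OF v] ..
      have L: "V_op N c z \<rho> \<tau> = K * ?\<phi> v"
        by (simp add: V_op_def K_def m_def flip: \<sigma>_def v_def)
      have R: "V_op N c z (eps_field u z' \<rho> + iota_op N z' \<rho>) \<tau> =
          K * (sym_scalar (du_at u z') * ((sym_gen ?g - sym_scalar (m * mero_eval ?g z)) * ?\<phi> v) +
            (?\<phi> (sym_deriv z' v) - sym_scalar (of_real (sqrt (real N)) * mero_eval (log_nabla \<sigma>) z') * ?\<phi> v))"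
        unfolding g[symmetric] V_op_def m_def[symmetric] \<sigma>_def[symmetric]
        by (simp add: eps_field_def iota_op_def wt_scale_def wt_act_def shift_hom_add
            shift_hom_mult shift_hom_diff K_def flip: v_def)
      show ?thesis
        unfolding R unfolding iota_op_def eps_field_def wt_scale_def wt_act_def L D
        using scal by (simp add: algebra_simps)
    qed
  qed
  then show ?thesis
    unfolding j_field_def V_field_eq[OF \<rho>z(1)] iota_field_eq[OF V] iota_field_eq[OF \<rho>z(2)]
      V_field_eq[OF j] by auto
qed

text \<open>Each order evaluates the shift produced by the first operator at the point of the
  second. This gives \<open>du_at u z * (z' - z)\<close> in one order and its negative in the other,
  both to the power \<open>- (int N * c * c')\<close>.\<close>

lemma V_coeff_swap:
  assumes "z \<noteq> z'" "\<sigma> \<noteq> 0" "unit_at \<sigma> z" "unit_at \<sigma> z'"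
  shows "V_coeff N c' z' (w z powi (- c) * \<sigma>) * V_coeff N c z \<sigma> =
    (-1) powi (int N * c * c') * (V_coeff N c z (w z' powi (- c') * \<sigma>) * V_coeff N c' z' \<sigma>)"
proof -
  let ?a = "du_at u z" and ?n = "int N * c * c'"
  have a: "?a \<noteq> 0" "du_at u z' = ?a" using w_simps(6)[of z] w_simps(7)[of z'] by auto
  have e: "mero_eval (w z powi (- c) * \<sigma>) z' = (?a * (z' - z)) powi (- c) * mero_eval \<sigma> z'"
    using unit_at_powi[OF unit_at_w[OF assms(1)], of "- c"] assms(4)
    by (simp add: unit_at_def regular_mult w_simps(2))
  have e': "mero_eval (w z' powi (- c') * \<sigma>) z = (?a * (z - z')) powi (- c') * mero_eval \<sigma> z"
    using unit_at_powi[OF unit_at_w[of z' z], of "- c'"] assms(1,3) a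
    by (simp add: unit_at_def regular_mult w_simps(2))
  have "?a * (z' - z) = - 1 * (?a * (z - z'))" by (simp add: algebra_simps)
  \<comment> \<open>A sign is its own inverse, so the negative exponent does not affect it.\<close>
  moreover have "inverse ((-1 :: complex) powi ?n) = (-1) powi ?n"
    by (cases "even ?n") simp_all
  ultimately have sgn: "(?a * (z' - z)) powi (- ?n) = (-1) powi ?n * (?a * (z - z')) powi (- ?n)"
    by (simp only: power_int_mult_distrib) (simp add: power_int_minus)
  have p: "((?a * (z' - z)) powi (- c) * mero_eval \<sigma> z') powi (int N * c') =
      (?a * (z' - z)) powi (- ?n) * mero_eval \<sigma> z' powi (int N * c')"
    by (simp add: power_int_mult_distrib mult_ac flip: power_int_mult)
  have p': "((?a * (z - z')) powi (- c') * mero_eval \<sigma> z) powi (int N * c) =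
      (?a * (z - z')) powi (- ?n) * mero_eval \<sigma> z powi (int N * c)"
    by (simp add: power_int_mult_distrib mult_ac flip: power_int_mult)
  \<comment> \<open>The total exponent of \<open>du\<close> is symmetric under exchanging
    \<open>c\<close> and \<open>c'\<close>.\<close>
  have q: "?a powi (- (int N * c' * (ord_P \<sigma> + c + c'))) * ?a powi (- (int N * c * (ord_P \<sigma> + c))) =
      ?a powi (- (int N * c * (ord_P \<sigma> + c' + c))) * ?a powi (- (int N * c' * (ord_P \<sigma> + c')))"
    using a(1) by (simp add: algebra_simps flip: power_int_add)
  show ?thesis
    unfolding V_coeff_def e e' ord_P_w_powi[OF assms(2)] a(2) p p' sgn
    using q by (simp add: mult_ac)
qed

lemma V_field_commute:
  assumes "z \<noteq> z'" and \<rho>: "\<rho> \<in> Wt N {z, z'}"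
  shows "V_field N u c' z' (V_field N u c z \<rho>) =
    wt_scale ((-1) powi (int N * c * c')) (V_field N u c z (V_field N u c' z' \<rho>))"
proof -
  have \<rho>z: "\<rho> \<in> Wt N {z}" "\<rho> \<in> Wt N {z'}"
    using Wt_mono[OF _ \<rho>, of "{z}"] Wt_mono[OF _ \<rho>, of "{z'}"] by auto
  have eq: "equivariant N {z, z'} \<rho>" using \<rho> by (simp add: Wt_iff)
  have "{z, z'} - {z} = {z'}" "{z, z'} - {z'} = {z}" using assms(1) by auto
  then have V: "V_op N c z \<rho> \<in> Wt N {z'}" "V_op N c' z' \<rho> \<in> Wt N {z}"
    using Wt_V_op[OF \<rho>, of z c] Wt_V_op[OF \<rho>, of z' c'] by simp_all
  have "V_op N c' z' (V_op N c z \<rho>) \<tau> =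
     sym_scalar ((-1) powi (int N * c * c')) * V_op N c z (V_op N c' z' \<rho>) \<tau>" for \<tau>
  proof -
    \<comment> \<open>Both compositions evaluate \<open>\<rho>\<close> at this same section, as the
      two multiplications commute.\<close>
    define \<sigma> where "\<sigma> = w z powi c * (w z' powi c' * \<tau>)"
    have s: "w z' powi c' * \<tau> = w z powi (- c) * \<sigma>" by (simp add: \<sigma>_def)
    have s': "w z powi c * \<tau> = w z' powi (- c') * \<sigma>"
      by (simp add: \<sigma>_def mult.left_commute[of "w z powi c"])
    let ?m = "of_real (sqrt (real N) * of_int c)" and ?m' = "of_real (sqrt (real N) * of_int c')"
    have L: "V_op N c' z' (V_op N c z \<rho>) \<tau> =
        sym_scalar (V_coeff N c' z' (w z powi (- c) * \<sigma>) * V_coeff N c z \<sigma>) *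
          shift_hom ?m' z' (shift_hom ?m z (\<rho> \<sigma>))"
      by (simp only: V_op_def s w_powi_cancel shift_hom_mult shift_hom_scalar sym_scalar_mult mult.assoc)
    have R: "V_op N c z (V_op N c' z' \<rho>) \<tau> =
        sym_scalar (V_coeff N c z (w z' powi (- c') * \<sigma>) * V_coeff N c' z' \<sigma>) *
          shift_hom ?m z (shift_hom ?m' z' (\<rho> \<sigma>))"
      by (simp only: V_op_def s' w_powi_cancel shift_hom_mult shift_hom_scalar sym_scalar_mult mult.assoc)
    show ?thesis
    proof (cases "\<rho> \<sigma> = 0")
      case True
      then show ?thesis unfolding L R by simp
    next
      case False
      then have "\<sigma> \<noteq> 0" "unit_at \<sigma> z" "unit_at \<sigma> z'"
        using equivariantD(1,2)[OF eq] by auto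
      from V_coeff_swap[OF assms(1) this] show ?thesis
        unfolding L R shift_hom_commute[OF equivariantD(3)[OF eq], of ?m' z']
        by (simp only: sym_scalar_mult mult.assoc)
    qed
  qed
  then show ?thesis
    unfolding V_field_eq[OF \<rho>z(1)] V_field_eq[OF \<rho>z(2)] V_field_eq[OF V(1)] V_field_eq[OF V(2)]
      wt_scale_def by auto
qed

end

text \<open>Vectors in \<open>Wt N {z, z'}\<close> are built from data regular at both points, so
  all compositions are defined on them; the exponent \<open>int N * c * c'\<close> is
  \<open>\<lambda>\<lambda>'\<close>.\<close>

theorem proposition15p2:
  fixes N :: nat and c c' :: int and u :: mero and z z' :: complex
  assumes "N > 0" and "coordinate u" and "z \<noteq> z'"
  shows "(\<forall>\<rho>\<in>Wt N {z, z'}.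
            j_field N u z' (V_field N u c z \<rho>) - V_field N u c z (j_field N u z' \<rho>) = 0) \<and>
         (\<forall>\<rho>\<in>Wt N {z, z'}.
            V_field N u c' z' (V_field N u c z \<rho>) =
            wt_scale ((-1) powi (int N * c * c')) (V_field N u c z (V_field N u c' z' \<rho>)))"
  using coord.j_field_V_field_commute[OF coord.intro assms(3)]
    coord.V_field_commute[OF coord.intro assms(3)] assms(2) by simp

end
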